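(* Let $a,b,c,\epsilon,\kappa,\lambda,\sigma$ be real constants with $(a+b)c\neq 0$ and with $\epsilon,\kappa,\lambda,\sigma$ not all zero, and consider the system for $u=u(t,x)$, $v=v(t,x)$ $$u_t+(a+b)vu_x+(au+c)v_x+\epsilon u_{txx}+\kappa v_{xxx}=0,\qquad v_t+(bu+c)u_x+(a+b)vv_x+\lambda u_{xxx}+\sigma v_{txx}=0 .$$ Put $$X_1=(a+b)\left(t\frac{\partial}{\partial t}-v\frac{\partial}{\partial v}\right)-2(au+c)\frac{\partial}{\partial u},\qquad X_2=\frac{\partial}{\partial t},$$ $$X_3=(a+b)\left(x\frac{\partial}{\partial x}+v\frac{\partial}{\partial v}\right)+2(au+c)\frac{\partial}{\partial u},\qquad X_4=(a+b)t\frac{\partial}{\partial x}+\frac{\partial}{\partial v},\qquad X_5=\frac{\partial}{\partial x}.$$ Then the real vector space of all infinitesimal generators of Lie point symmetries of this system is spanned by the following operators. (A) Case $\epsilon=\sigma=0$: - if $b=0$: $X_2,X_4,X_5$, together with $X_1$ when $\kappa=0$, and together with $2X_1+X_3$ when $\lambda=0$; - if $a=b$: $3X_1+X_3$, $X_2$, $X_4$, $X_5$; - if $b(a-b)\neq 0$: $X_2,X_4,X_5$. (B) Case $(\epsilon,\sigma)\neq(0,0)$: - if $b=0$: $X_2,X_5$, together with $X_1$ when $\kappa=0$; - if $a=b$: $X_2,X_5$, together with $X_1$ when $\kappa=\lambda=0$; - if $b(a-b)\neq 0$: $X_2,X_5$.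
   Context: A Lie point symmetry generator of the system $F_1=0$, $F_2=0$ (with $F_1,F_2$ the left-hand sides of the two equations) is an operator $$X=\mathcal T(t,x,u,v)\frac{\partial}{\partial t}+\mathcal X(t,x,u,v)\frac{\partial}{\partial x}+\mathcal U(t,x,u,v)\frac{\partial}{\partial u}+\mathcal V(t,x,u,v)\frac{\partial}{\partial v}$$ with smooth coefficients whose third prolongation $X^{(3)}$ to the space of $(t,x,u,v)$ and derivatives of $u,v$ up to order three satisfies $X^{(3)}F_1=0$ and $X^{(3)}F_2=0$ whenever $F_1=F_2=0$. *)

theory Defs
  imports "HOL-Analysis.Analysis" "HOL-Library.Function_Algebras"
begin

text \<open>Functions into a real vector space, with the pointwise operations, form a real vector
  space; this makes \<^const>\<open>span\<close> available for vector fields.\<close>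

instantiation "fun" :: (type, real_vector) real_vector
begin

definition scaleR_fun :: "real \<Rightarrow> ('a \<Rightarrow> 'b) \<Rightarrow> 'a \<Rightarrow> 'b"
  where "scaleR_fun r f = (\<lambda>x. r *\<^sub>R f x)"

instance
  by standard (simp_all add: scaleR_fun_def fun_eq_iff scaleR_add_right scaleR_add_left)

end

text \<open>\<open>C_k n f\<close>: on the whole space, \<open>f\<close> has continuous iterated directional derivatives up to
  order \<open>n\<close>.\<close>

primrec C_k :: "nat \<Rightarrow> ('a::real_normed_vector \<Rightarrow> 'b::real_normed_vector) \<Rightarrow> bool" where
  "C_k 0 f \<longleftrightarrow> continuous_on UNIV f"
| "C_k (Suc n) f \<longleftrightarrow>
     (\<forall>p. f differentiable (at p)) \<and> (\<forall>w. C_k n (\<lambda>p. frechet_derivative f (at p) w))"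

definition smooth :: "('a::real_normed_vector \<Rightarrow> 'b::real_normed_vector) \<Rightarrow> bool"
  where "smooth f \<longleftrightarrow> (\<forall>n. C_k n f)"

text \<open>Jet space of two dependent variables \<open>u, v\<close> of two independent variables \<open>t, x\<close>.
  The coordinate \<open>Der w i j\<close> stands for the derivative of \<open>w\<close> taken \<open>i\<close> times in \<open>t\<close> and \<open>j\<close>
  times in \<open>x\<close>; in particular \<open>Der w 0 0\<close> is \<open>w\<close> itself.  A point assigns values to the
  coordinates of all orders; a function on the space of jets of order \<open>n\<close> is a function that
  depends only on the coordinates with \<open>i + j \<le> n\<close>.\<close>

datatype dep_var = U_var | V_var

datatype coord = T_coord | X_coord | Der dep_var nat nat

type_synonym jet = "coord \<Rightarrow> real"

definition jet_partial :: "coord \<Rightarrow> (jet \<Rightarrow> real) \<Rightarrow> jet \<Rightarrow> real"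
  where "jet_partial q F z = deriv (\<lambda>s. F (z(q := s))) (z q)"

text \<open>Total derivatives of functions on the space of jets of order \<open>n\<close>.\<close>

definition total_t :: "nat \<Rightarrow> (jet \<Rightarrow> real) \<Rightarrow> jet \<Rightarrow> real" where
  "total_t n F z = jet_partial T_coord F z
     + (\<Sum>w\<in>{U_var, V_var}. \<Sum>i\<le>n. \<Sum>j\<le>n - i. z (Der w (Suc i) j) * jet_partial (Der w i j) F z)"

definition total_x :: "nat \<Rightarrow> (jet \<Rightarrow> real) \<Rightarrow> jet \<Rightarrow> real" where
  "total_x n F z = jet_partial X_coord F z
     + (\<Sum>w\<in>{U_var, V_var}. \<Sum>i\<le>n. \<Sum>j\<le>n - i. z (Der w i (Suc j)) * jet_partial (Der w i j) F z)"

text \<open>A vector field on the space of \<open>(t, x, u, v)\<close> is given by its coefficients with respect to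
  \<open>\<partial>/\<partial>t, \<partial>/\<partial>x, \<partial>/\<partial>u, \<partial>/\<partial>v\<close>, in this order.\<close>

type_synonym vfield = "real \<times> real \<times> real \<times> real \<Rightarrow> real \<times> real \<times> real \<times> real"

definition base :: "jet \<Rightarrow> real \<times> real \<times> real \<times> real"
  where "base z = (z T_coord, z X_coord, z (Der U_var 0 0), z (Der V_var 0 0))"

definition coeff_t :: "vfield \<Rightarrow> jet \<Rightarrow> real"
  where "coeff_t Y z = fst (Y (base z))"

definition coeff_x :: "vfield \<Rightarrow> jet \<Rightarrow> real"
  where "coeff_x Y z = fst (snd (Y (base z)))"

definition coeff_dep :: "vfield \<Rightarrow> dep_var \<Rightarrow> jet \<Rightarrow> real" where
  "coeff_dep Y w z = (case w of
       U_var \<Rightarrow> fst (snd (snd (Y (base z))))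
     | V_var \<Rightarrow> snd (snd (snd (Y (base z)))))"

text \<open>\<open>prolong_coeff Y w i j\<close> is the coefficient of \<open>\<partial>/\<partial>(Der w i j)\<close> in the prolongation of \<open>Y\<close>,
  a function on the space of jets of order \<open>i + j\<close>, given by the usual recursion
  \<open>\<zeta>\<^bsub>J,k\<^esub> = D\<^sub>k \<zeta>\<^sub>J - w\<^bsub>J,t\<^esub> D\<^sub>k \<T> - w\<^bsub>J,x\<^esub> D\<^sub>k \<X>\<close>.  As \<open>D\<^sub>t\<close> and \<open>D\<^sub>x\<close> commute, the order in which
  the derivatives are taken (here the \<open>x\<close>-derivatives first) does not matter.\<close>

fun prolong_coeff :: "vfield \<Rightarrow> dep_var \<Rightarrow> nat \<Rightarrow> nat \<Rightarrow> jet \<Rightarrow> real" where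
  "prolong_coeff Y w 0 0 = coeff_dep Y w"
| "prolong_coeff Y w 0 (Suc j) = (\<lambda>z. total_x j (prolong_coeff Y w 0 j) z
     - z (Der w 1 j) * total_x 0 (coeff_t Y) z
     - z (Der w 0 (Suc j)) * total_x 0 (coeff_x Y) z)"
| "prolong_coeff Y w (Suc i) j = (\<lambda>z. total_t (i + j) (prolong_coeff Y w i j) z
     - z (Der w (Suc i) j) * total_t 0 (coeff_t Y) z
     - z (Der w i (Suc j)) * total_t 0 (coeff_x Y) z)"

definition prolong :: "nat \<Rightarrow> vfield \<Rightarrow> (jet \<Rightarrow> real) \<Rightarrow> jet \<Rightarrow> real" where
  "prolong n Y F z = coeff_t Y z * jet_partial T_coord F z + coeff_x Y z * jet_partial X_coord F z
     + (\<Sum>w\<in>{U_var, V_var}. \<Sum>i\<le>n. \<Sum>j\<le>n - i. prolong_coeff Y w i j z * jet_partial (Der w i j) F z)"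

definition symmetry_generator :: "nat \<Rightarrow> (jet \<Rightarrow> real) \<Rightarrow> (jet \<Rightarrow> real) \<Rightarrow> vfield \<Rightarrow> bool" where
  "symmetry_generator n F1 F2 Y \<longleftrightarrow> smooth Y \<and>
     (\<forall>z. F1 z = 0 \<and> F2 z = 0 \<longrightarrow> prolong n Y F1 z = 0 \<and> prolong n Y F2 z = 0)"

definition lhs1 :: "real \<Rightarrow> real \<Rightarrow> real \<Rightarrow> real \<Rightarrow> real \<Rightarrow> jet \<Rightarrow> real" where
  "lhs1 a b c \<epsilon> \<kappa> z = z (Der U_var 1 0)
     + (a + b) * z (Der V_var 0 0) * z (Der U_var 0 1)
     + (a * z (Der U_var 0 0) + c) * z (Der V_var 0 1)
     + \<epsilon> * z (Der U_var 1 2) + \<kappa> * z (Der V_var 0 3)"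

definition lhs2 :: "real \<Rightarrow> real \<Rightarrow> real \<Rightarrow> real \<Rightarrow> real \<Rightarrow> jet \<Rightarrow> real" where
  "lhs2 a b c lam \<sigma> z = z (Der V_var 1 0)
     + (b * z (Der U_var 0 0) + c) * z (Der U_var 0 1)
     + (a + b) * z (Der V_var 0 0) * z (Der V_var 0 1)
     + lam * z (Der U_var 0 3) + \<sigma> * z (Der V_var 1 2)"

definition symmetries :: "real \<Rightarrow> real \<Rightarrow> real \<Rightarrow> real \<Rightarrow> real \<Rightarrow> real \<Rightarrow> real \<Rightarrow> vfield set" where
  "symmetries a b c \<epsilon> \<kappa> lam \<sigma> =
     {Y. symmetry_generator 3 (lhs1 a b c \<epsilon> \<kappa>) (lhs2 a b c lam \<sigma>) Y}"

definition X1 :: "real \<Rightarrow> real \<Rightarrow> real \<Rightarrow> vfield"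
  where "X1 a b c = (\<lambda>(t, x, u, v). ((a + b) * t, 0, - 2 * (a * u + c), - (a + b) * v))"

definition X2 :: vfield
  where "X2 = (\<lambda>(t, x, u, v). (1, 0, 0, 0))"

definition X3 :: "real \<Rightarrow> real \<Rightarrow> real \<Rightarrow> vfield"
  where "X3 a b c = (\<lambda>(t, x, u, v). (0, (a + b) * x, 2 * (a * u + c), (a + b) * v))"

definition X4 :: "real \<Rightarrow> real \<Rightarrow> vfield"
  where "X4 a b = (\<lambda>(t, x, u, v). (0, (a + b) * t, 0, 1))"

definition X5 :: vfield
  where "X5 = (\<lambda>(t, x, u, v). (0, 1, 0, 0))"

end

theory Submission
  imports Defs
begin

text \<open>
  Each equation contains the \<open>t\<close>-derivative of one of the unknowns with coefficient 1, so on the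
  solution variety \<open>u\<^sub>t\<close> and \<open>v\<^sub>t\<close> are functions of the other jet coordinates, and these are free.
  Invariance of the system under \<open>Y = \<T>\<partial>\<^sub>t + \<X>\<partial>\<^sub>x + \<U>\<partial>\<^sub>u + \<V>\<partial>\<^sub>v\<close> is therefore an identity between
  polynomials in free variables, whose coefficients are functions on the space of \<open>(t, x, u, v)\<close>.
  A coefficient is read off by comparing the values of the polynomial at a few jets over one point.

  The terms of highest order fix the shape of \<open>Y\<close>.  In a dispersive equation the coefficient of
  \<open>w\<^sub>t\<^sub>t\<^sub>x\<close> (or \<open>w\<^sub>t\<^sub>x\<^sub>x\<close>) gives \<open>\<T> = \<T>(t)\<close>, products of second derivatives give \<open>\<X> = \<X>(t, x)\<close>,
  and the coefficients of \<open>w\<^sub>t\<^sub>x\<close> and \<open>w\<^sub>x\<^sub>x\<close> show that the component of \<open>Y\<close> along the unknown in the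
  dispersive term is affine in \<open>(u, v)\<close>.  After that the invariance condition is affine in the
  free coordinates (\<open>\<delta>_reduced\<close>), and what is left are the coefficients of third derivatives
  (\<open>coefficient_w_txx\<close> and its companions), of \<open>u\<^sub>x\<close> and \<open>v\<^sub>x\<close> (\<open>first_order_coefficients\<close>), and the
  free terms (\<open>jet_free_terms\<close>).

  The equations for \<open>u\<^sub>x\<close> and \<open>v\<^sub>x\<close> leave little room.  The sum of two of them is free of \<open>\<U>\<^sub>v\<close> and
  \<open>\<V>\<^sub>u\<close> and expresses \<open>\<V>\<close> by \<open>\<T>\<close> and \<open>\<X>\<close>; the other two carry the factors \<open>a u + c\<close> and \<open>b u + c\<close>
  and make \<open>\<U>\<close> a multiple of \<open>a u + c\<close>.  With the free terms all functions of \<open>t\<close> and \<open>x\<close> that are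
  still open become polynomials of degree at most one, and every symmetry is a combination
  \<open>\<alpha> X\<^sub>1 + \<beta> X\<^sub>3 + s X\<^sub>2 + g X\<^sub>4 + r X\<^sub>5\<close> (\<open>symmetry_is_combination\<close>).

  For such a combination the prolonged field multiplies each left-hand side by a constant, up to
  a few explicit terms (\<open>prolong_combination\<close>).  Hence being a symmetry is a system of linear
  conditions on \<open>\<alpha>, \<beta>, g\<close>, given in \<open>combination_symmetry_iff\<close>, and solving it case by case yields
  the list of generators.
\<close>

section \<open>Directional derivatives of smooth functions\<close>

text \<open>The direction comes first, so that \<open>pd a\<close> is an operator on functions and can be iterated.\<close>

definition pd :: "'a::real_normed_vector \<Rightarrow> ('a \<Rightarrow> real) \<Rightarrow> 'a \<Rightarrow> real"
  where "pd a f p = frechet_derivative f (at p) a"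

lemma smooth_differentiable: "smooth f \<Longrightarrow> f differentiable (at p)"
  using C_k.simps(2) unfolding smooth_def by blast

lemma smooth_pd: "smooth f \<Longrightarrow> smooth (pd a f)"
  unfolding smooth_def pd_def[abs_def] using C_k.simps(2) by blast

lemma smooth_continuous: "smooth f \<Longrightarrow> continuous_on UNIV f"
  unfolding smooth_def using C_k.simps(1) by blast

lemma C_k_SucD: "C_k (Suc n) f \<Longrightarrow> C_k n f"
proof (induction n arbitrary: f)
  case 0
  then have "f differentiable (at p)" for p
    unfolding C_k.simps by blast
  then show ?case
    unfolding C_k.simps(1) continuous_on_eq_continuous_at[OF open_UNIV]
    using differentiable_imp_continuous_within by blast
next
  case (Suc n)
  from Suc.prems have 1: "f differentiable (at p)" and 2: "C_k (Suc n) (\<lambda>p. frechet_derivative f (at p) w)" for p w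
    unfolding C_k.simps(2)[of "Suc n"] by blast+
  show ?case
    unfolding C_k.simps(2)[of n] using 1 Suc.IH[OF 2] by blast
qed

text \<open>The definition of \<^const>\<open>C_k\<close> refers to a chosen derivative; this rule accepts any.\<close>

lemma C_k_SucI:
  assumes "\<And>p. (f has_derivative f' p) (at p)" "\<And>w. C_k n (\<lambda>p. f' p w)"
  shows "C_k (Suc n) f"
proof -
  have "frechet_derivative f (at p) = f' p" for p
    using frechet_derivative_at[OF assms(1)] by metis
  then show ?thesis
    unfolding C_k.simps differentiable_def using assms by auto
qed

lemma C_k_SucE:
  assumes "C_k (Suc n) f"
  shows "(f has_derivative frechet_derivative f (at p)) (at p)"
    and "C_k n (\<lambda>p. frechet_derivative f (at p) w)"
  using assms unfolding C_k.simps frechet_derivative_works by blast+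

lemma C_k_const: "C_k n (\<lambda>_. c)"
  by (induction n arbitrary: c) (auto simp: frechet_derivative_const)

lemma C_k_linear_compose:
  assumes L: "bounded_linear L"
  shows "C_k n f \<Longrightarrow> C_k n (\<lambda>p. L (f p))"
proof (induction n arbitrary: f)
  case 0
  then show ?case
    by (simp add: bounded_linear.continuous_on[OF L])
next
  case (Suc n)
  note f = C_k_SucE[OF Suc.prems]
  show ?case
    by (rule C_k_SucI[OF bounded_linear.has_derivative[OF L f(1)] Suc.IH[OF f(2)]])
qed

lemma C_k_add: "C_k n f \<Longrightarrow> C_k n g \<Longrightarrow> C_k n (\<lambda>p. f p + g p)"
proof (induction n arbitrary: f g)
  case 0
  then show ?case by (simp add: continuous_on_add)
next
  case (Suc n)
  note f = C_k_SucE[OF Suc.prems(1)] and g = C_k_SucE[OF Suc.prems(2)]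
  show ?case
    by (rule C_k_SucI[OF has_derivative_add[OF f(1) g(1)] Suc.IH[OF f(2) g(2)]])
qed

lemma C_k_mult:
  fixes f g :: "'a::real_normed_vector \<Rightarrow> real"
  shows "C_k n f \<Longrightarrow> C_k n g \<Longrightarrow> C_k n (\<lambda>p. f p * g p)"
proof (induction n arbitrary: f g)
  case 0
  then show ?case by (simp add: continuous_on_mult)
next
  case (Suc n)
  note f = C_k_SucE[OF Suc.prems(1)] and g = C_k_SucE[OF Suc.prems(2)]
  note f0 = C_k_SucD[OF Suc.prems(1)] and g0 = C_k_SucD[OF Suc.prems(2)]
  show ?case
    by (rule C_k_SucI[OF has_derivative_mult[OF f(1) g(1)]
          C_k_add[OF Suc.IH[OF f0 g(2)] Suc.IH[OF f(2) g0]]])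
qed

lemma smooth_linear_compose: "bounded_linear L \<Longrightarrow> smooth f \<Longrightarrow> smooth (\<lambda>p. L (f p))"
  by (simp add: smooth_def C_k_linear_compose)

lemma smooth_affine:
  assumes "bounded_linear L"
  shows "smooth (\<lambda>p. L p + c)"
proof -
  have "((\<lambda>p. L p + c) has_derivative L) (at p)" for p
    using bounded_linear_imp_has_derivative[OF assms] by (auto intro!: derivative_eq_intros)
  then have "C_k (Suc n) (\<lambda>p. L p + c)" for n
    by (rule C_k_SucI[where f' = "\<lambda>_. L"]) (rule C_k_const)
  then show ?thesis
    unfolding smooth_def using C_k_SucD by blast
qed

lemma pd_has_derivative: "(f has_derivative f') (at p) \<Longrightarrow> pd a f p = f' a"
  unfolding pd_def using frechet_derivative_at by metis

lemma pd_const [simp]: "pd a (\<lambda>_. c) = (\<lambda>_. 0)"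
  by (simp add: pd_def[abs_def])

lemma smooth_const [simp]: "smooth (\<lambda>_. c)"
  by (simp add: smooth_def C_k_const)

lemma smooth_add [simp]: "smooth f \<Longrightarrow> smooth g \<Longrightarrow> smooth (\<lambda>p. f p + g p)"
  by (simp add: smooth_def C_k_add)

lemma smooth_mult [simp]:
  fixes f g :: "'a::real_normed_vector \<Rightarrow> real"
  shows "smooth f \<Longrightarrow> smooth g \<Longrightarrow> smooth (\<lambda>p. f p * g p)"
  by (simp add: smooth_def C_k_mult)

lemma smooth_diff [simp]:
  fixes f g :: "'a::real_normed_vector \<Rightarrow> real"
  shows "smooth f \<Longrightarrow> smooth g \<Longrightarrow> smooth (\<lambda>p. f p - g p)"
  using smooth_add[OF _ smooth_mult[OF smooth_const[of "- 1"]], of f g] by simp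

lemma pd_ring [simp]:
  fixes f g :: "'a::real_normed_vector \<Rightarrow> real"
  assumes "smooth f" "smooth g"
  shows "pd d (\<lambda>p. f p + g p) = (\<lambda>p. pd d f p + pd d g p)"
    "pd d (\<lambda>p. f p - g p) = (\<lambda>p. pd d f p - pd d g p)"
    "pd d (\<lambda>p. f p * g p) = (\<lambda>p. f p * pd d g p + pd d f p * g p)"
proof -
  have der: "(f has_derivative (\<lambda>h. pd h f p)) (at p)" "(g has_derivative (\<lambda>h. pd h g p)) (at p)" for p
    using assms[THEN smooth_differentiable, of p] unfolding pd_def frechet_derivative_works .
  show "pd d (\<lambda>p. f p + g p) = (\<lambda>p. pd d f p + pd d g p)"
    by (rule ext, rule pd_has_derivative) (rule has_derivative_add[OF der])
  show "pd d (\<lambda>p. f p - g p) = (\<lambda>p. pd d f p - pd d g p)"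
    by (rule ext, rule pd_has_derivative) (rule has_derivative_diff[OF der])
  show "pd d (\<lambda>p. f p * g p) = (\<lambda>p. f p * pd d g p + pd d f p * g p)"
    by (rule ext, rule pd_has_derivative) (rule has_derivative_mult[OF der])
qed

lemma smooth_pd_cmult [simp]:
  fixes f :: "'a::real_normed_vector \<Rightarrow> real"
  assumes "smooth f"
  shows "smooth (\<lambda>p. f p / c)" "smooth (\<lambda>p. - f p)"
    "pd d (\<lambda>p. f p / c) = (\<lambda>p. pd d f p / c)" "pd d (\<lambda>p. - f p) = (\<lambda>p. - pd d f p)"
  using smooth_mult[OF smooth_const[of "1 / c"] assms] smooth_mult[OF smooth_const[of "- 1"] assms]
    pd_ring(3)[OF smooth_const[of "1 / c"] assms, of d] pd_ring(3)[OF smooth_const[of "- 1"] assms, of d]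
  by simp_all

lemma smooth_Pair:
  assumes f: "smooth f" and g: "smooth g"
  shows "smooth (\<lambda>p. (f p, g p))"
proof -
  have "bounded_linear (\<lambda>x. (x, 0))" "bounded_linear (\<lambda>y. (0, y))"
    by (intro bounded_linear_Pair bounded_linear_ident bounded_linear_zero)+
  from smooth_add[OF smooth_linear_compose[OF this(1) f] smooth_linear_compose[OF this(2) g]]
  show ?thesis by simp
qed

text \<open>Directional derivatives are ordinary derivatives along lines, which makes the one-dimensional
  mean value theorem applicable.\<close>

lemma DERIV_along:
  assumes "f differentiable (at (p + s *\<^sub>R a))"
  shows "((\<lambda>s. f (p + s *\<^sub>R a)) has_real_derivative pd a f (p + s *\<^sub>R a)) (at s)"
proof -
  have "((\<lambda>s. f (p + s *\<^sub>R a)) has_derivative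
      (\<lambda>h. frechet_derivative f (at (p + s *\<^sub>R a)) (h *\<^sub>R a))) (at s)"
    by (rule has_derivative_compose[where f = "\<lambda>s. p + s *\<^sub>R a" and g = f])
      (use assms in \<open>auto intro!: derivative_eq_intros simp: frechet_derivative_works\<close>)
  then show ?thesis
    by (simp add: has_field_derivative_def pd_def linear_scale[OF linear_frechet_derivative[OF assms]]
        mult_commute_abs)
qed

text \<open>The mean value theorem, applied first in direction \<open>a\<close> to the difference in direction \<open>b\<close> and
  then in direction \<open>b\<close>.  The left-hand side is symmetric in \<open>a\<close> and \<open>b\<close>.\<close>

lemma second_difference:
  fixes f :: "'a::real_normed_vector \<Rightarrow> real"
  assumes f: "\<And>q. f differentiable (at q)" and fa: "\<And>q. pd a f differentiable (at q)"
    and h: "h > 0"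
  shows "\<exists>r s. 0 < r \<and> r < h \<and> 0 < s \<and> s < h \<and>
    f (p + h *\<^sub>R a + h *\<^sub>R b) - f (p + h *\<^sub>R a) - f (p + h *\<^sub>R b) + f p
      = h * h * pd b (pd a f) (p + r *\<^sub>R a + s *\<^sub>R b)"
proof -
  have "\<exists>r>0. r < h \<and>
      (f ((p + h *\<^sub>R b) + h *\<^sub>R a) - f (p + h *\<^sub>R a)) - (f ((p + h *\<^sub>R b) + 0 *\<^sub>R a) - f (p + 0 *\<^sub>R a))
      = (h - 0) * (pd a f ((p + h *\<^sub>R b) + r *\<^sub>R a) - pd a f (p + r *\<^sub>R a))"
    by (rule MVT2[OF h]) (intro DERIV_diff DERIV_along f)
  then obtain r where r: "0 < r" "r < h"
    and 1: "f ((p + h *\<^sub>R b) + h *\<^sub>R a) - f (p + h *\<^sub>R a) - f (p + h *\<^sub>R b) + f p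
      = h * (pd a f ((p + h *\<^sub>R b) + r *\<^sub>R a) - pd a f (p + r *\<^sub>R a))"
    by (auto simp: algebra_simps)
  have "\<exists>s>0. s < h \<and> pd a f ((p + r *\<^sub>R a) + h *\<^sub>R b) - pd a f ((p + r *\<^sub>R a) + 0 *\<^sub>R b)
      = (h - 0) * pd b (pd a f) ((p + r *\<^sub>R a) + s *\<^sub>R b)"
    by (rule MVT2[OF h]) (intro DERIV_along fa)
  then obtain s where "0 < s" "s < h"
    and "pd a f ((p + r *\<^sub>R a) + h *\<^sub>R b) - pd a f (p + r *\<^sub>R a)
      = h * pd b (pd a f) ((p + r *\<^sub>R a) + s *\<^sub>R b)"
    by auto
  with r 1 show ?thesis
    by (intro exI[of _ r] exI[of _ s]) (simp add: add_ac)
qed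

text \<open>Schwarz's theorem.  By \<open>second_difference\<close> both mixed derivatives take a common value at two points
  arbitrarily close to \<open>p\<close>, and both are continuous.\<close>

lemma pd_commute:
  fixes f :: "'a::real_normed_vector \<Rightarrow> real"
  assumes "smooth f"
  shows "pd a (pd b f) = pd b (pd a f)"
proof (rule ext, rule ccontr)
  fix p
  assume ne: "pd a (pd b f) p \<noteq> pd b (pd a f) p"
  define e where "e = \<bar>pd a (pd b f) p - pd b (pd a f) p\<bar> / 2"
  have e: "e > 0" using ne by (simp add: e_def)
  note sm = assms smooth_pd[OF assms, of a] smooth_pd[OF assms, of b]
  have "continuous (at p) (pd a (pd b f))" "continuous (at p) (pd b (pd a f))"
    using sm[THEN smooth_pd, THEN smooth_continuous] by (simp_all add: continuous_on_eq_continuous_at)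
  note cont = this[unfolded continuous_at_eps_delta, rule_format, OF e]
  obtain d1 d2 where d: "d1 > 0" "d2 > 0"
    and d1: "\<And>q. dist q p < d1 \<Longrightarrow> dist (pd a (pd b f) q) (pd a (pd b f) p) < e"
    and d2: "\<And>q. dist q p < d2 \<Longrightarrow> dist (pd b (pd a f) q) (pd b (pd a f) p) < e"
    using cont by blast
  define h where "h = min d1 d2 / (norm a + norm b + 1)"
  have pos: "0 < norm a + norm b + 1"
    by (simp add: add_nonneg_pos)
  then have h: "h > 0"
    using d by (simp add: h_def)
  have close: "dist (p + r *\<^sub>R a + s *\<^sub>R b) p < min d1 d2"
    if "0 < r" "r < h" "0 < s" "s < h" for r s
  proof -
    have "dist (p + r *\<^sub>R a + s *\<^sub>R b) p \<le> r * norm a + s * norm b"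
      using that norm_triangle_ineq[of "r *\<^sub>R a" "s *\<^sub>R b"] by (simp add: dist_norm add.assoc)
    also have "\<dots> \<le> h * norm a + h * norm b"
      using that by (intro add_mono mult_right_mono) auto
    also have "\<dots> < h * (norm a + norm b + 1)"
      using h by (simp add: algebra_simps)
    also have "\<dots> = min d1 d2"
      using pos by (simp add: h_def)
    finally show ?thesis .
  qed
  obtain r s where rs: "0 < r" "r < h" "0 < s" "s < h"
    and 1: "f (p + h *\<^sub>R a + h *\<^sub>R b) - f (p + h *\<^sub>R a) - f (p + h *\<^sub>R b) + f p
      = h * h * pd b (pd a f) (p + r *\<^sub>R a + s *\<^sub>R b)"
    using second_difference[of f a h p b] smooth_differentiable sm h by metis
  obtain r' s' where rs': "0 < r'" "r' < h" "0 < s'" "s' < h"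
    and 2: "f (p + h *\<^sub>R b + h *\<^sub>R a) - f (p + h *\<^sub>R b) - f (p + h *\<^sub>R a) + f p
      = h * h * pd a (pd b f) (p + r' *\<^sub>R b + s' *\<^sub>R a)"
    using second_difference[of f b h p a] smooth_differentiable sm h by metis
  have swap: "p + h *\<^sub>R b + h *\<^sub>R a = p + h *\<^sub>R a + h *\<^sub>R b"
    "p + r' *\<^sub>R b + s' *\<^sub>R a = p + s' *\<^sub>R a + r' *\<^sub>R b"
    by (simp_all add: add_ac)
  then have "h * h * pd b (pd a f) (p + r *\<^sub>R a + s *\<^sub>R b)
      = h * h * pd a (pd b f) (p + s' *\<^sub>R a + r' *\<^sub>R b)"
    using 1 2 unfolding swap by linarith
  then have "pd b (pd a f) (p + r *\<^sub>R a + s *\<^sub>R b) = pd a (pd b f) (p + s' *\<^sub>R a + r' *\<^sub>R b)"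
    using h by simp
  then have "dist (pd a (pd b f) p) (pd b (pd a f) p) < e + e"
    using d1[of "p + s' *\<^sub>R a + r' *\<^sub>R b"] d2[of "p + r *\<^sub>R a + s *\<^sub>R b"]
      close[OF rs] close[OF rs'(3,4,1,2)] dist_triangle3 by (smt (verit) dist_commute)
  then show False
    by (simp add: e_def dist_real_def)
qed

section \<open>Functions of the four base variables\<close>

type_synonym scalar = "real \<times> real \<times> real \<times> real \<Rightarrow> real"

abbreviation "d_t \<equiv> pd (1::real, 0::real, 0::real, 0::real)"
abbreviation "d_x \<equiv> pd (0::real, 1::real, 0::real, 0::real)"
abbreviation "d_u \<equiv> pd (0::real, 0::real, 1::real, 0::real)"
abbreviation "d_v \<equiv> pd (0::real, 0::real, 0::real, 1::real)"

lemma bounded_linear_coordinates: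
  "bounded_linear (fst :: real \<times> real \<times> real \<times> real \<Rightarrow> real)"
  "bounded_linear (\<lambda>p :: real \<times> real \<times> real \<times> real. fst (snd p))"
  "bounded_linear (\<lambda>p :: real \<times> real \<times> real \<times> real. fst (snd (snd p)))"
  "bounded_linear (\<lambda>p :: real \<times> real \<times> real \<times> real. snd (snd (snd p)))"
  by (intro bounded_linear_fst bounded_linear_fst_comp bounded_linear_snd_comp bounded_linear_ident)+

lemma smooth_coordinates [simp]:
  "smooth (fst :: real \<times> real \<times> real \<times> real \<Rightarrow> real)"
  "smooth (\<lambda>p :: real \<times> real \<times> real \<times> real. fst (snd p))"
  "smooth (\<lambda>p :: real \<times> real \<times> real \<times> real. fst (snd (snd p)))"
  "smooth (\<lambda>p :: real \<times> real \<times> real \<times> real. snd (snd (snd p)))"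
  using bounded_linear_coordinates[THEN smooth_affine, of 0] by simp_all

lemma pd_coordinates [simp]:
  "pd d (fst :: real \<times> real \<times> real \<times> real \<Rightarrow> real) = (\<lambda>_. fst d)"
  "pd d (\<lambda>p :: real \<times> real \<times> real \<times> real. fst (snd p)) = (\<lambda>_. fst (snd d))"
  "pd d (\<lambda>p :: real \<times> real \<times> real \<times> real. fst (snd (snd p))) = (\<lambda>_. fst (snd (snd d)))"
  "pd d (\<lambda>p :: real \<times> real \<times> real \<times> real. snd (snd (snd p))) = (\<lambda>_. snd (snd (snd d)))"
  by (rule ext, rule pd_has_derivative, rule bounded_linear_imp_has_derivative, rule bounded_linear_coordinates)+

text \<open>The hyperplane where \<open>m u + c\<close> vanishes has no interior, so continuity removes the factor
  everywhere.  With \<open>m = a\<close> and \<open>m = b\<close> these are the coefficients of the quasilinear part of the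
  system.\<close>

lemma affine_factor_cancel:
  fixes f :: "real \<times> real \<times> real \<times> real \<Rightarrow> real"
  assumes f: "smooth f" and c: "c \<noteq> 0" and z: "\<And>p. (m * fst (snd (snd p)) + c) * f p = 0"
  shows "f = (\<lambda>_. 0)"
proof
  fix p
  show "f p = 0"
  proof (cases "m * fst (snd (snd p)) + c = 0")
    case True
    then have m: "m \<noteq> 0" using c by auto
    let ?l = "\<lambda>s::real. p + s *\<^sub>R (0, 0, 1, 0)"
    have "isCont f (?l 0)"
      using smooth_continuous[OF f] unfolding continuous_on_eq_continuous_at[OF open_UNIV] by blast
    then have "isCont (\<lambda>s. f (?l s)) 0"
      by (rule isCont_o2[rotated]) (intro continuous_intros)
    then have "(\<lambda>s. f (?l s)) \<midarrow>0\<rightarrow> f p"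
      by (simp add: isCont_def flip: zero_prod_def)
    moreover have "f (?l s) = 0" if "s \<noteq> 0" for s
    proof -
      have "m * fst (snd (snd (?l s))) + c = m * s"
        using True by (simp add: distrib_left)
      then show ?thesis
        using z[of "?l s"] m that by (simp only: mult_eq_0_iff) simp
    qed
    then have "(\<lambda>s. f (?l s)) \<midarrow>0\<rightarrow> 0"
      by (intro tendsto_eventually) (auto simp: eventually_at_filter)
    ultimately show ?thesis
      by (rule LIM_unique)
  next
    case False
    then show ?thesis using z[of p] by simp
  qed
qed

text \<open>Subtracting the affine function leaves a function with zero derivative.\<close>

lemma affine_if_pd_const:
  assumes f: "smooth f" and d: "d_t f = (\<lambda>_. \<alpha>)" "d_x f = (\<lambda>_. \<beta>)" "d_u f = (\<lambda>_. \<gamma>)" "d_v f = (\<lambda>_. \<delta>)"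
  obtains f0 where "\<And>t x u v. f (t, x, u, v) = f0 + \<alpha> * t + \<beta> * x + \<gamma> * u + \<delta> * v"
proof -
  let ?L = "\<lambda>p. \<alpha> * fst p + \<beta> * fst (snd p) + \<gamma> * fst (snd (snd p)) + \<delta> * snd (snd (snd p))"
  have der: "(f has_derivative ?L) (at p)" for p
  proof -
    have lin: "linear (frechet_derivative f (at p))"
      by (intro linear_frechet_derivative smooth_differentiable f)
    have "frechet_derivative f (at p) h = ?L h" for h
    proof -
      have h: "h = fst h *\<^sub>R (1, 0, 0, 0) + fst (snd h) *\<^sub>R (0, 1, 0, 0)
          + fst (snd (snd h)) *\<^sub>R (0, 0, 1, 0) + snd (snd (snd h)) *\<^sub>R (0, 0, 0, 1)"
        by (cases h) auto
      have *: "frechet_derivative f (at p) (1, 0, 0, 0) = \<alpha>" "frechet_derivative f (at p) (0, 1, 0, 0) = \<beta>"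
        "frechet_derivative f (at p) (0, 0, 1, 0) = \<gamma>" "frechet_derivative f (at p) (0, 0, 0, 1) = \<delta>"
        using d[THEN fun_cong, of p] by (simp_all add: pd_def)
      show ?thesis
        by (subst h) (simp add: linear_add[OF lin] linear_scale[OF lin] * mult.commute
          del: add_Pair scaleR_Pair)
    qed
    then have "frechet_derivative f (at p) = ?L" by auto
    then show ?thesis
      using smooth_differentiable[OF f, of p] by (simp add: frechet_derivative_works)
  qed
  have "((\<lambda>p. f p - ?L p) has_derivative (\<lambda>_. 0)) (at p within UNIV)" for p
  proof -
    have "(?L has_derivative ?L) (at p)" by (auto intro!: derivative_eq_intros)
    from has_derivative_diff[OF der this] show ?thesis by simp
  qed
  from has_derivative_zero_constant[OF convex_UNIV this]
  obtain f0 where "\<And>p. f p - ?L p = f0" by auto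
  then have "f (t, x, u, v) = f0 + \<alpha> * t + \<beta> * x + \<gamma> * u + \<delta> * v" for t x u v
    by (simp add: algebra_simps)
  then show thesis by (rule that)
qed

section \<open>Total derivatives on jet space\<close>

text \<open>Functions of jets are only ever differentiated along single coordinates, so differentiability is
  asked for along coordinate lines.\<close>

definition jdiff :: "(jet \<Rightarrow> real) \<Rightarrow> bool"
  where "jdiff F \<longleftrightarrow> (\<forall>q z. (\<lambda>s. F (z(q := s))) differentiable (at (z q)))"

lemma jdiff_DERIV:
  "jdiff F \<Longrightarrow> ((\<lambda>s. F (z(q := s))) has_real_derivative jet_partial q F z) (at (z q))"
  by (simp add: jdiff_def jet_partial_def DERIV_deriv_iff_real_differentiable)

lemma jet_partialI:
  "((\<lambda>s. F (z(q := s))) has_real_derivative D) (at (z q)) \<Longrightarrow> jet_partial q F z = D"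
  by (simp add: jet_partial_def DERIV_imp_deriv)

lemma jdiffI:
  "(\<And>q z. ((\<lambda>s. F (z(q := s))) has_real_derivative D q z) (at (z q))) \<Longrightarrow> jdiff F"
  unfolding jdiff_def using real_differentiable_def by blast

lemma jdiff_const [simp]: "jdiff (\<lambda>_. c)"
  by (rule jdiffI[where D = "\<lambda>_ _. 0"]) simp

lemma DERIV_coord:
  "((\<lambda>s. (z(q := s)) q') has_real_derivative (if q = q' then 1 else 0)) (at (z q))"
  by (cases "q = q'") auto

lemma jdiff_coord [simp]: "jdiff (\<lambda>z. z q)"
  by (rule jdiffI[OF DERIV_coord])

lemma jdiff_add [simp]: "jdiff F \<Longrightarrow> jdiff G \<Longrightarrow> jdiff (\<lambda>z. F z + G z)"
  unfolding jdiff_def by (intro allI differentiable_add) simp_all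

lemma jdiff_diff [simp]: "jdiff F \<Longrightarrow> jdiff G \<Longrightarrow> jdiff (\<lambda>z. F z - G z)"
  unfolding jdiff_def by (intro allI differentiable_diff) simp_all

lemma jdiff_mult [simp]: "jdiff F \<Longrightarrow> jdiff G \<Longrightarrow> jdiff (\<lambda>z. F z * G z)"
  unfolding jdiff_def by (intro allI differentiable_mult) simp_all

lemma jet_partial_const [simp]: "jet_partial q (\<lambda>_. c) z = 0"
  by (rule jet_partialI) simp

lemma jet_partial_coord [simp]: "jet_partial q (\<lambda>z. z q') z = (if q = q' then 1 else 0)"
  by (rule jet_partialI[OF DERIV_coord])

lemma jet_partial_add [simp]:
  "jdiff F \<Longrightarrow> jdiff G \<Longrightarrow> jet_partial q (\<lambda>z. F z + G z) z = jet_partial q F z + jet_partial q G z"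
  by (intro jet_partialI DERIV_add jdiff_DERIV)

lemma jet_partial_diff [simp]:
  "jdiff F \<Longrightarrow> jdiff G \<Longrightarrow> jet_partial q (\<lambda>z. F z - G z) z = jet_partial q F z - jet_partial q G z"
  by (intro jet_partialI DERIV_diff jdiff_DERIV)

lemma jet_partial_mult [simp]:
  "jdiff F \<Longrightarrow> jdiff G \<Longrightarrow>
    jet_partial q (\<lambda>z. F z * G z) z = F z * jet_partial q G z + jet_partial q F z * G z"
  using jet_partialI[of "\<lambda>z. F z * G z", OF DERIV_mult[OF jdiff_DERIV[where q = q and z = z] jdiff_DERIV[where q = q and z = z]]]
  by (simp add: mult.commute add.commute)

text \<open>The direction in which the base point moves when one jet coordinate moves: zero for the
  coordinates that are proper derivatives.\<close>

fun axis_of :: "coord \<Rightarrow> real \<times> real \<times> real \<times> real" where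
  "axis_of T_coord = (1, 0, 0, 0)"
| "axis_of X_coord = (0, 1, 0, 0)"
| "axis_of (Der U_var i j) = (if i = 0 \<and> j = 0 then (0, 0, 1, 0) else (0, 0, 0, 0))"
| "axis_of (Der V_var i j) = (if i = 0 \<and> j = 0 then (0, 0, 0, 1) else (0, 0, 0, 0))"

lemma base_upd: "base (z(q := s)) = base z + (s - z q) *\<^sub>R axis_of q"
  by (cases q rule: axis_of.cases) (auto simp: base_def)

lemma DERIV_base:
  assumes "f differentiable (at (base z))"
  shows "((\<lambda>s. f (base (z(q := s)))) has_real_derivative pd (axis_of q) f (base z)) (at (z q))"
proof -
  have "((\<lambda>s. f (base z + s *\<^sub>R axis_of q)) has_real_derivative pd (axis_of q) f (base z)) (at (z q - z q))"
    using DERIV_along[of f "base z" 0 "axis_of q"] assms by simp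
  then have "((\<lambda>s. f (base z + (s - z q) *\<^sub>R axis_of q)) has_real_derivative pd (axis_of q) f (base z) * 1) (at (z q))"
    by (rule DERIV_chain2) (auto intro!: derivative_eq_intros)
  then show ?thesis by (simp add: base_upd)
qed

lemma jdiff_base [simp]: "smooth f \<Longrightarrow> jdiff (\<lambda>z. f (base z))"
  by (rule jdiffI, rule DERIV_base, rule smooth_differentiable)

lemma jet_partial_base [simp]:
  "smooth f \<Longrightarrow> jet_partial q (\<lambda>z. f (base z)) z = pd (axis_of q) f (base z)"
  by (rule jet_partialI[OF DERIV_base]) (rule smooth_differentiable)

lemma pd_zero [simp]: "smooth f \<Longrightarrow> pd 0 f p = 0"
  using linear_0[OF linear_frechet_derivative[OF smooth_differentiable]] by (simp add: pd_def)

text \<open>A total derivative sums over the triangle of coordinates up to a given order; for a coordinate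
  function or a function of the base point only one of the summands survives.\<close>

lemma triangle_sum_delta:
  fixes g :: "nat \<Rightarrow> nat \<Rightarrow> real"
  assumes "k + l \<le> n"
  shows "(\<Sum>i\<le>n. \<Sum>j\<le>n - i. g i j * (if i = k \<and> j = l then c else 0)) = g k l * c"
proof -
  have "(\<Sum>j\<le>n - i. g i j * (if i = k \<and> j = l then c else 0)) = (if i = k then g k l * c else 0)" for i
    using assms by (cases "i = k") (auto simp: if_distrib[of "\<lambda>y. _ * y"] cong: if_cong)
  then show ?thesis using assms by simp
qed

context
  fixes n :: nat and z :: jet
begin

lemma total_const [simp]: "total_t n (\<lambda>_. c) z = 0" "total_x n (\<lambda>_. c) z = 0"
  by (simp_all add: total_t_def total_x_def)

lemma total_add [simp]:
  assumes "jdiff F" "jdiff G"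
  shows "total_t n (\<lambda>z. F z + G z) z = total_t n F z + total_t n G z"
    "total_x n (\<lambda>z. F z + G z) z = total_x n F z + total_x n G z"
  using assms by (simp_all add: total_t_def total_x_def sum.distrib algebra_simps)

lemma total_diff [simp]:
  assumes "jdiff F" "jdiff G"
  shows "total_t n (\<lambda>z. F z - G z) z = total_t n F z - total_t n G z"
    "total_x n (\<lambda>z. F z - G z) z = total_x n F z - total_x n G z"
  using assms by (simp_all add: total_t_def total_x_def sum_subtractf algebra_simps)

lemma total_mult [simp]:
  assumes "jdiff F" "jdiff G"
  shows "total_t n (\<lambda>z. F z * G z) z = F z * total_t n G z + total_t n F z * G z"
    "total_x n (\<lambda>z. F z * G z) z = F z * total_x n G z + total_x n F z * G z"
  using assms
  by (simp_all add: total_t_def total_x_def sum.distrib sum_distrib_left sum_distrib_right algebra_simps)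

lemma total_coord [simp]:
  assumes "i + j \<le> n"
  shows "total_t n (\<lambda>z. z (Der w i j)) z = z (Der w (Suc i) j)"
    "total_x n (\<lambda>z. z (Der w i j)) z = z (Der w i (Suc j))"
  by (cases w; simp add: total_t_def total_x_def triangle_sum_delta[OF assms])+

lemma total_base:
  assumes "smooth f"
  shows "total_t n (\<lambda>z. f (base z)) z
      = d_t f (base z) + z (Der U_var 1 0) * d_u f (base z) + z (Der V_var 1 0) * d_v f (base z)"
    "total_x n (\<lambda>z. f (base z)) z
      = d_x f (base z) + z (Der U_var 0 1) * d_u f (base z) + z (Der V_var 0 1) * d_v f (base z)"
proof -
  have ax: "pd (axis_of (Der w i j)) f (base z)
      = (if i = 0 \<and> j = 0 then (case w of U_var \<Rightarrow> d_u f (base z) | V_var \<Rightarrow> d_v f (base z)) else 0)" for w i j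
    using pd_zero[OF assms] by (cases w) (auto simp: zero_prod_def)
  show "total_t n (\<lambda>z. f (base z)) z
      = d_t f (base z) + z (Der U_var 1 0) * d_u f (base z) + z (Der V_var 1 0) * d_v f (base z)"
    "total_x n (\<lambda>z. f (base z)) z
      = d_x f (base z) + z (Der U_var 0 1) * d_u f (base z) + z (Der V_var 0 1) * d_v f (base z)"
    using assms triangle_sum_delta[of 0 0 n]
    by (simp_all add: total_t_def total_x_def ax del: axis_of.simps(3,4))
qed

end

section \<open>The third prolongation in closed form\<close>

text \<open>Iterated total derivatives of a function of the base point, with the \<open>x\<close>-derivatives taken first.
  The iterates are arranged by the Leibniz rule, for instance
  \<open>D\<^sub>x\<^sup>2 f = D\<^sub>x f\<^sub>x + D\<^sub>x (u\<^sub>x f\<^sub>u) + D\<^sub>x (v\<^sub>x f\<^sub>v)\<close>, so that terms disappear as soon as a partial derivative of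
  \<open>f\<close> is known to be zero.\<close>

definition Dx :: "scalar \<Rightarrow> jet \<Rightarrow> real" where
  "Dx f z = d_x f (base z) + z (Der U_var 0 1) * d_u f (base z) + z (Der V_var 0 1) * d_v f (base z)"

definition Dt :: "scalar \<Rightarrow> jet \<Rightarrow> real" where
  "Dt f z = d_t f (base z) + z (Der U_var 1 0) * d_u f (base z) + z (Der V_var 1 0) * d_v f (base z)"

definition Dxx :: "scalar \<Rightarrow> jet \<Rightarrow> real" where
  "Dxx f z = Dx (d_x f) z
     + (z (Der U_var 0 1) * Dx (d_u f) z + z (Der U_var 0 2) * d_u f (base z))
     + (z (Der V_var 0 1) * Dx (d_v f) z + z (Der V_var 0 2) * d_v f (base z))"

definition Dxxx :: "scalar \<Rightarrow> jet \<Rightarrow> real" where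
  "Dxxx f z = Dxx (d_x f) z
     + (z (Der U_var 0 1) * Dxx (d_u f) z + 2 * z (Der U_var 0 2) * Dx (d_u f) z
        + z (Der U_var 0 3) * d_u f (base z))
     + (z (Der V_var 0 1) * Dxx (d_v f) z + 2 * z (Der V_var 0 2) * Dx (d_v f) z
        + z (Der V_var 0 3) * d_v f (base z))"

definition Dtx :: "scalar \<Rightarrow> jet \<Rightarrow> real" where
  "Dtx f z = Dt (d_x f) z
     + (z (Der U_var 0 1) * Dt (d_u f) z + z (Der U_var 1 1) * d_u f (base z))
     + (z (Der V_var 0 1) * Dt (d_v f) z + z (Der V_var 1 1) * d_v f (base z))"

definition Dtxx :: "scalar \<Rightarrow> jet \<Rightarrow> real" where
  "Dtxx f z = Dtx (d_x f) z
     + (z (Der U_var 0 1) * Dtx (d_u f) z + z (Der U_var 1 1) * Dx (d_u f) z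
        + z (Der U_var 0 2) * Dt (d_u f) z + z (Der U_var 1 2) * d_u f (base z))
     + (z (Der V_var 0 1) * Dtx (d_v f) z + z (Der V_var 1 1) * Dx (d_v f) z
        + z (Der V_var 0 2) * Dt (d_v f) z + z (Der V_var 1 2) * d_v f (base z))"

lemma jdiff_D [simp]:
  assumes "smooth f"
  shows "jdiff (Dx f)" "jdiff (Dxx f)"
proof -
  have Dx: "jdiff (Dx f)" if "smooth f" for f
    unfolding Dx_def[abs_def] using that by (intro jdiff_add jdiff_mult jdiff_base jdiff_coord smooth_pd)
  show "jdiff (Dx f)" by (rule Dx[OF assms])
  show "jdiff (Dxx f)"
    unfolding Dxx_def[abs_def]
    using assms by (intro jdiff_add jdiff_mult jdiff_base jdiff_coord smooth_pd Dx)
qed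

text \<open>The bounds \<open>Suc n\<close> and \<open>Suc (Suc n)\<close> reflect that \<open>Dx f\<close> and \<open>Dxx f\<close> are functions on jets of order 1
  and 2: a total derivative with a smaller bound would miss their top coordinates.\<close>

lemma total_D:
  assumes "smooth f"
  shows "total_t n (\<lambda>z. f (base z)) = Dt f" "total_x n (\<lambda>z. f (base z)) = Dx f"
    "total_t (Suc n) (Dx f) = Dtx f" "total_x (Suc n) (Dx f) = Dxx f"
    "total_t (Suc (Suc n)) (Dxx f) = Dtxx f" "total_x (Suc (Suc n)) (Dxx f) = Dxxx f"
proof -
  note smooth_pd [simp]
  have 0: "total_t n (\<lambda>z. f (base z)) = Dt f" "total_x n (\<lambda>z. f (base z)) = Dx f" if "smooth f" for n f
    using that by (simp_all add: fun_eq_iff total_base Dt_def Dx_def)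
  have 1: "total_t (Suc n) (Dx f) = Dtx f" "total_x (Suc n) (Dx f) = Dxx f" if "smooth f" for n f
    unfolding Dx_def[abs_def]
    using that by (simp_all add: fun_eq_iff 0 Dtx_def Dxx_def eval_nat_numeral)
  show "total_t n (\<lambda>z. f (base z)) = Dt f" "total_x n (\<lambda>z. f (base z)) = Dx f"
    "total_t (Suc n) (Dx f) = Dtx f" "total_x (Suc n) (Dx f) = Dxx f"
    using 0 1 assms by simp_all
  show "total_t (Suc (Suc n)) (Dxx f) = Dtxx f" "total_x (Suc (Suc n)) (Dxx f) = Dxxx f"
    unfolding Dxx_def[abs_def]
    using assms by (simp_all add: fun_eq_iff 0 1 Dtxx_def Dxxx_def eval_nat_numeral algebra_simps)
qed

text \<open>Indexing the components along \<open>u\<close> and \<open>v\<close> by \<^typ>\<open>dep_var\<close> allows one argument to serve both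
  equations.\<close>

definition vf :: "scalar \<Rightarrow> scalar \<Rightarrow> (dep_var \<Rightarrow> scalar) \<Rightarrow> vfield"
  where "vf T X W = (\<lambda>p. (T p, X p, W U_var p, W V_var p))"

context
  fixes T X :: scalar and W :: "dep_var \<Rightarrow> scalar"
  assumes sm [simp]: "smooth T" "smooth X" "\<And>w. smooth (W w)"
begin

lemma coeff_vf:
  "coeff_t (vf T X W) = (\<lambda>z. T (base z))" "coeff_x (vf T X W) = (\<lambda>z. X (base z))"
  "coeff_dep (vf T X W) w = (\<lambda>z. W w (base z))"
  by (auto simp: coeff_t_def coeff_x_def coeff_dep_def vf_def fun_eq_iff split: dep_var.split)

text \<open>The Leibniz rule applied to \<open>\<zeta>\<^sub>J = D\<^sub>J (\<W> - w\<^sub>t \<T> - w\<^sub>x \<X>) + \<T> w\<^sub>J\<^sub>t + \<X> w\<^sub>J\<^sub>x\<close>: the terms in which no derivative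
  falls on \<open>\<T>\<close> or \<open>\<X>\<close> cancel.\<close>

lemma prolong_coeff_vf:
  "prolong_coeff (vf T X W) w 1 0 =
     (\<lambda>z. Dt (W w) z - z (Der w 1 0) * Dt T z - z (Der w 0 1) * Dt X z)" (is ?t)
  "prolong_coeff (vf T X W) w 0 1 =
     (\<lambda>z. Dx (W w) z - z (Der w 1 0) * Dx T z - z (Der w 0 1) * Dx X z)" (is ?x)
  "prolong_coeff (vf T X W) w 0 3 =
     (\<lambda>z. Dxxx (W w) z - (3 * z (Der w 1 2) * Dx T z + 3 * z (Der w 1 1) * Dxx T z + z (Der w 1 0) * Dxxx T z)
        - (3 * z (Der w 0 3) * Dx X z + 3 * z (Der w 0 2) * Dxx X z + z (Der w 0 1) * Dxxx X z))" (is ?xxx)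
  "prolong_coeff (vf T X W) w 1 2 =
     (\<lambda>z. Dtxx (W w) z
        - (2 * z (Der w 2 1) * Dx T z + 2 * z (Der w 1 1) * Dtx T z + z (Der w 2 0) * Dxx T z
           + z (Der w 1 0) * Dtxx T z + z (Der w 1 2) * Dt T z)
        - (2 * z (Der w 1 2) * Dx X z + 2 * z (Der w 0 2) * Dtx X z + z (Der w 1 1) * Dxx X z
           + z (Der w 0 1) * Dtxx X z + z (Der w 0 3) * Dt X z))" (is ?txx)
proof -
  note [simp] = total_D smooth_pd and [simp del] = prolong_coeff.simps
  note num = numeral_3_eq_3 numeral_2_eq_2 One_nat_def
  show ?t ?x
    by (simp_all add: prolong_coeff.simps coeff_vf fun_eq_iff)
  have xx: "prolong_coeff (vf T X W) w 0 (Suc (Suc 0)) =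
     (\<lambda>z. Dxx (W w) z - (2 * z (Der w 1 1) * Dx T z + z (Der w 1 0) * Dxx T z)
        - (2 * z (Der w 0 2) * Dx X z + z (Der w 0 1) * Dxx X z))"
    by (simp add: prolong_coeff.simps coeff_vf fun_eq_iff num algebra_simps)
  show ?xxx
    unfolding num prolong_coeff.simps(2)[of _ _ "Suc (Suc 0)"] xx
    by (simp add: coeff_vf fun_eq_iff num algebra_simps)
  show ?txx
    unfolding num prolong_coeff.simps(3)[of _ _ _ "Suc (Suc 0)"] xx
    by (simp add: coeff_vf fun_eq_iff num algebra_simps)
qed

end

lemma sum_triangle_3:
  fixes g :: "nat \<Rightarrow> nat \<Rightarrow> real"
  shows "(\<Sum>i\<le>3. \<Sum>j\<le>3 - i. g i j) = g 0 0 + g 0 1 + g 0 2 + g 0 3 + g 1 0 + g 1 1 + g 1 2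
    + g 2 0 + g 2 1 + g 3 0"
  by (simp add: eval_nat_numeral)

text \<open>The prolonged field acts as a derivation on the polynomials \<open>F\<^sub>1\<close> and \<open>F\<^sub>2\<close>, whose coefficients do not
  involve \<open>t\<close> and \<open>x\<close>.\<close>

lemma prolong_lhs:
  fixes Y z
  defines "\<zeta> \<equiv> \<lambda>w i j. prolong_coeff Y w i j z"
  shows "prolong 3 Y (lhs1 a b c \<epsilon> \<kappa>) z = \<zeta> U_var 1 0
      + (a + b) * (\<zeta> V_var 0 0 * z (Der U_var 0 1) + z (Der V_var 0 0) * \<zeta> U_var 0 1)
      + a * \<zeta> U_var 0 0 * z (Der V_var 0 1) + (a * z (Der U_var 0 0) + c) * \<zeta> V_var 0 1
      + \<epsilon> * \<zeta> U_var 1 2 + \<kappa> * \<zeta> V_var 0 3"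
    and "prolong 3 Y (lhs2 a b c lam \<sigma>) z = \<zeta> V_var 1 0
      + b * \<zeta> U_var 0 0 * z (Der U_var 0 1) + (b * z (Der U_var 0 0) + c) * \<zeta> U_var 0 1
      + (a + b) * (\<zeta> V_var 0 0 * z (Der V_var 0 1) + z (Der V_var 0 0) * \<zeta> V_var 0 1)
      + lam * \<zeta> U_var 0 3 + \<sigma> * \<zeta> V_var 1 2"
  unfolding prolong_def \<zeta>_def lhs1_def[abs_def] lhs2_def[abs_def]
  by (simp_all add: sum_triangle_3 algebra_simps del: prolong_coeff.simps)

section \<open>The invariance condition on solutions\<close>

fun other :: "dep_var \<Rightarrow> dep_var" where
  "other U_var = V_var"
| "other V_var = U_var"

text \<open>The quasilinear first-order part of the equation that contains \<open>w\<^sub>t\<close>.\<close>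

fun advection :: "real \<Rightarrow> real \<Rightarrow> real \<Rightarrow> dep_var \<Rightarrow> jet \<Rightarrow> real" where
  "advection a b c U_var z = (a + b) * z (Der V_var 0 0) * z (Der U_var 0 1)
     + (a * z (Der U_var 0 0) + c) * z (Der V_var 0 1)"
| "advection a b c V_var z = (b * z (Der U_var 0 0) + c) * z (Der U_var 0 1)
     + (a + b) * z (Der V_var 0 0) * z (Der V_var 0 1)"

text \<open>The derivative of \<^const>\<open>advection\<close> along the prolonged field with coefficients \<open>\<zeta>\<close>.\<close>

fun advection_variation :: "real \<Rightarrow> real \<Rightarrow> real \<Rightarrow> (dep_var \<Rightarrow> nat \<Rightarrow> nat \<Rightarrow> real) \<Rightarrow> dep_var \<Rightarrow> jet \<Rightarrow> real" where
  "advection_variation a b c \<zeta> U_var z = (a + b) * (\<zeta> V_var 0 0 * z (Der U_var 0 1) + z (Der V_var 0 0) * \<zeta> U_var 0 1)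
      + a * \<zeta> U_var 0 0 * z (Der V_var 0 1) + (a * z (Der U_var 0 0) + c) * \<zeta> V_var 0 1"
| "advection_variation a b c \<zeta> V_var z = b * \<zeta> U_var 0 0 * z (Der U_var 0 1) + (b * z (Der U_var 0 0) + c) * \<zeta> U_var 0 1
      + (a + b) * (\<zeta> V_var 0 0 * z (Der V_var 0 1) + z (Der V_var 0 0) * \<zeta> V_var 0 1)"

text \<open>Solving both equations for \<open>u\<^sub>t\<close> and \<open>v\<^sub>t\<close> projects the jet space onto the solution variety and
  leaves all other coordinates free.  In the equation for \<open>w\<^sub>t\<close> the dispersive terms are
  \<open>e w \<cdot> w\<^sub>t\<^sub>x\<^sub>x\<close> and \<open>k w \<cdot> w'\<^sub>x\<^sub>x\<^sub>x\<close>, where \<open>w'\<close> is the other unknown.\<close>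

definition on_shell :: "real \<Rightarrow> real \<Rightarrow> real \<Rightarrow> (dep_var \<Rightarrow> real) \<Rightarrow> (dep_var \<Rightarrow> real) \<Rightarrow> jet \<Rightarrow> jet" where
  "on_shell a b c e k z = z(
     Der U_var 1 0 := - (advection a b c U_var z + e U_var * z (Der U_var 1 2) + k U_var * z (Der V_var 0 3)),
     Der V_var 1 0 := - (advection a b c V_var z + e V_var * z (Der V_var 1 2) + k V_var * z (Der U_var 0 3)))"

text \<open>The prolonged field applied to the left-hand side of the equation that contains \<open>w\<^sub>t\<close>.\<close>

definition variation where
  "variation a b c e k T X W w z = (let \<zeta> = \<lambda>w i j. prolong_coeff (vf T X W) w i j z in
      \<zeta> w 1 0 + advection_variation a b c \<zeta> w z + e w * \<zeta> w 1 2 + k w * \<zeta> (other w) 0 3)"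

text \<open>The jet over \<open>p\<close> whose proper derivatives all vanish.  Changing a few of its coordinates isolates
  single coefficients of a polynomial in the derivatives.\<close>

definition over :: "real \<times> real \<times> real \<times> real \<Rightarrow> jet" where
  "over p q = (case q of T_coord \<Rightarrow> fst p | X_coord \<Rightarrow> fst (snd p)
     | Der w i j \<Rightarrow> if i = 0 \<and> j = 0
         then (case w of U_var \<Rightarrow> fst (snd (snd p)) | V_var \<Rightarrow> snd (snd (snd p))) else 0)"

lemma over_simps [simp]:
  "over p T_coord = fst p" "over p X_coord = fst (snd p)"
  "over p (Der U_var 0 0) = fst (snd (snd p))" "over p (Der V_var 0 0) = snd (snd (snd p))"
  "i \<noteq> 0 \<or> j \<noteq> 0 \<Longrightarrow> over p (Der w i j) = 0"
  by (auto simp: over_def)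

lemma base_over [simp]: "base (over p) = p"
  by (simp add: base_def)

lemma base_upd_Der [simp]: "i \<noteq> 0 \<or> j \<noteq> 0 \<Longrightarrow> base (z(Der w i j := s)) = base z"
  by (auto simp: base_def)

lemma base_on_shell [simp]: "base (on_shell a b c e k z) = base z"
  by (simp add: on_shell_def)

lemma on_shell_simps [simp]:
  "i \<noteq> 1 \<or> j \<noteq> 0 \<Longrightarrow> on_shell a b c e k z (Der w i j) = z (Der w i j)"
  "on_shell a b c e k z (Der U_var (Suc 0) 0)
     = - (advection a b c U_var z + e U_var * z (Der U_var 1 2) + k U_var * z (Der V_var 0 3))"
  "on_shell a b c e k z (Der V_var (Suc 0) 0)
     = - (advection a b c V_var z + e V_var * z (Der V_var 1 2) + k V_var * z (Der U_var 0 3))"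
  by (auto simp: on_shell_def)

lemma D_zero [simp]:
  "Dx (\<lambda>_. 0) z = 0" "Dt (\<lambda>_. 0) z = 0" "Dxx (\<lambda>_. 0) z = 0" "Dtx (\<lambda>_. 0) z = 0"
  "Dxxx (\<lambda>_. 0) z = 0" "Dtxx (\<lambda>_. 0) z = 0"
proof -
  show 1: "Dx (\<lambda>_. 0) z = 0" "Dt (\<lambda>_. 0) z = 0" for z
    by (simp_all add: Dx_def Dt_def)
  show 2: "Dxx (\<lambda>_. 0) z = 0" "Dtx (\<lambda>_. 0) z = 0" for z
    by (simp_all add: Dxx_def Dtx_def 1)
  show "Dxxx (\<lambda>_. 0) z = 0" "Dtxx (\<lambda>_. 0) z = 0"
    by (simp_all add: Dxxx_def Dtxx_def 1 2)
qed

lemma axes_commute: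
  assumes "smooth f"
  shows "d_x (d_t f) = d_t (d_x f)" "d_u (d_t f) = d_t (d_u f)" "d_v (d_t f) = d_t (d_v f)"
    "d_u (d_x f) = d_x (d_u f)" "d_v (d_x f) = d_x (d_v f)" "d_v (d_u f) = d_u (d_v f)"
  using assms by (rule pd_commute)+

abbreviation d_dep :: "dep_var \<Rightarrow> scalar \<Rightarrow> scalar"
  where "d_dep w \<equiv> pd (axis_of (Der w 0 0))"

text \<open>How the total derivatives depend on one coordinate of second or third order.  Factors 2 and 3
  arise because mixed partial derivatives of \<open>f\<close> commute.\<close>

lemma D_upd:
  "Dx f (z(Der w 1 1 := s)) = Dx f z"
  "Dt f (z(Der w 1 1 := s)) = Dt f z"
  "Dxx f (z(Der w 1 1 := s)) = Dxx f z"
  "Dtx f (z(Der w 1 1 := s)) = Dtx f z + (s - z (Der w 1 1)) * d_dep w f (base z)"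
  "Dxxx f (z(Der w 1 1 := s)) = Dxxx f z"
  "smooth f \<Longrightarrow> Dtxx f (z(Der w 1 1 := s)) = Dtxx f z + 2 * (s - z (Der w 1 1)) * Dx (d_dep w f) z"
  "Dx f (z(Der w 0 2 := s)) = Dx f z"
  "Dt f (z(Der w 0 2 := s)) = Dt f z"
  "Dxx f (z(Der w 0 2 := s)) = Dxx f z + (s - z (Der w 0 2)) * d_dep w f (base z)"
  "Dtx f (z(Der w 0 2 := s)) = Dtx f z"
  "smooth f \<Longrightarrow> Dxxx f (z(Der w 0 2 := s)) = Dxxx f z + 3 * (s - z (Der w 0 2)) * Dx (d_dep w f) z"
  "Dtxx f (z(Der w 0 2 := s)) = Dtxx f z + (s - z (Der w 0 2)) * Dt (d_dep w f) z"
  "Dx f (z(Der w 1 2 := s)) = Dx f z"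
  "Dt f (z(Der w 1 2 := s)) = Dt f z"
  "Dxx f (z(Der w 1 2 := s)) = Dxx f z"
  "Dtx f (z(Der w 1 2 := s)) = Dtx f z"
  "Dxxx f (z(Der w 1 2 := s)) = Dxxx f z"
  "Dtxx f (z(Der w 1 2 := s)) = Dtxx f z + (s - z (Der w 1 2)) * d_dep w f (base z)"
  "Dx f (z(Der w 2 1 := s)) = Dx f z"
  "Dt f (z(Der w 2 1 := s)) = Dt f z"
  "Dxx f (z(Der w 2 1 := s)) = Dxx f z"
  "Dtx f (z(Der w 2 1 := s)) = Dtx f z"
  "Dxxx f (z(Der w 2 1 := s)) = Dxxx f z"
  "Dtxx f (z(Der w 2 1 := s)) = Dtxx f z"
  by (cases w; simp add: Dx_def Dt_def Dxx_def Dtx_def Dxxx_def Dtxx_def axes_commute algebra_simps)+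

text \<open>Both equations at once: \<open>e\<close> stands for the pair \<open>\<epsilon>, \<sigma>\<close> and \<open>k\<close> for the pair \<open>\<kappa>, \<lambda>\<close>.\<close>

locale infinitesimal_symmetry =
  fixes a b c :: real and e k :: "dep_var \<Rightarrow> real" and T X :: scalar and W :: "dep_var \<Rightarrow> scalar"
  assumes smT [simp]: "smooth T" and smX [simp]: "smooth X" and smW [simp]: "smooth (W w)"
    and dispersive: "\<exists>w. e w \<noteq> 0 \<or> k w \<noteq> 0"
    and invariance: "\<And>z w. z = on_shell a b c e k z \<Longrightarrow> variation a b c e k T X W w z = 0"
begin

abbreviation "U \<equiv> W U_var"
abbreviation "V \<equiv> W V_var"
abbreviation "shell \<equiv> on_shell a b c e k"
abbreviation "\<delta> \<equiv> variation a b c e k T X W"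

lemma \<delta>_shell: "\<delta> w (shell z) = 0"
  by (rule invariance) (auto simp: fun_eq_iff on_shell_def)

lemma \<delta>_expand:
  "\<delta> w z = (Dt (W w) z - z (Der w 1 0) * Dt T z - z (Der w 0 1) * Dt X z)
    + (case w of
         U_var \<Rightarrow> (a + b) * (V (base z) * z (Der U_var 0 1)
             + z (Der V_var 0 0) * (Dx U z - z (Der U_var 1 0) * Dx T z - z (Der U_var 0 1) * Dx X z))
           + a * U (base z) * z (Der V_var 0 1)
           + (a * z (Der U_var 0 0) + c) * (Dx V z - z (Der V_var 1 0) * Dx T z - z (Der V_var 0 1) * Dx X z)
       | V_var \<Rightarrow> b * U (base z) * z (Der U_var 0 1)
           + (b * z (Der U_var 0 0) + c) * (Dx U z - z (Der U_var 1 0) * Dx T z - z (Der U_var 0 1) * Dx X z)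
           + (a + b) * (V (base z) * z (Der V_var 0 1)
             + z (Der V_var 0 0) * (Dx V z - z (Der V_var 1 0) * Dx T z - z (Der V_var 0 1) * Dx X z)))
    + e w * (Dtxx (W w) z
        - (2 * z (Der w 2 1) * Dx T z + 2 * z (Der w 1 1) * Dtx T z + z (Der w 2 0) * Dxx T z
           + z (Der w 1 0) * Dtxx T z + z (Der w 1 2) * Dt T z)
        - (2 * z (Der w 1 2) * Dx X z + 2 * z (Der w 0 2) * Dtx X z + z (Der w 1 1) * Dxx X z
           + z (Der w 0 1) * Dtxx X z + z (Der w 0 3) * Dt X z))
    + k w * (Dxxx (W (other w)) z
        - (3 * z (Der (other w) 1 2) * Dx T z + 3 * z (Der (other w) 1 1) * Dxx T z
           + z (Der (other w) 1 0) * Dxxx T z)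
        - (3 * z (Der (other w) 0 3) * Dx X z + 3 * z (Der (other w) 0 2) * Dxx X z
           + z (Der (other w) 0 1) * Dxxx X z))"
  by (cases w) (simp_all only: variation_def Let_def prolong_coeff_vf[OF smT smX smW] advection_variation.simps
      prolong_coeff.simps(1) coeff_vf[OF smT smX smW] dep_var.case other.simps)

text \<open>Coordinates that do not occur in the equations can be changed without leaving the solution
  variety.\<close>

lemma shell_upd: "\<lbrakk>i + j \<ge> 2; (i, j) \<noteq> (0, 3); i = 1 \<and> j = 2 \<longrightarrow> e w = 0\<rbrakk> \<Longrightarrow>
  (shell z)(Der w i j := s) = shell (z(Der w i j := s))"
  by (cases w) (auto simp: on_shell_def fun_eq_iff)

section \<open>The shape of the coefficients of a symmetry\<close>

text \<open>If \<open>e w \<noteq> 0\<close>, then \<open>w\<^sub>t\<^sub>t\<^sub>x\<close> occurs in the condition for the equation of \<open>w\<close> only in the term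
  \<open>- 2 e w \<cdot> w\<^sub>t\<^sub>t\<^sub>x \<cdot> D\<^sub>x \<T>\<close>.  If \<open>e = 0\<close> and \<open>k w \<noteq> 0\<close>, then \<open>w'\<^sub>t\<^sub>x\<^sub>x\<close> is free as well and occurs only in
  \<open>- 3 k w \<cdot> w'\<^sub>t\<^sub>x\<^sub>x \<cdot> D\<^sub>x \<T>\<close>.\<close>

lemma T_only_t_aux: "Dx T (shell z) = 0"
proof (cases "\<exists>w. e w \<noteq> 0")
  case True
  then obtain w where w: "e w \<noteq> 0" by blast
  have "\<delta> w ((shell z)(Der w 2 1 := s)) = \<delta> w ((shell z)(Der w 2 1 := 0)) - 2 * e w * s * Dx T (shell z)" for s
    by (cases w; simp add: \<delta>_expand D_upd[simplified] algebra_simps)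
  from this[of 1] show ?thesis
    using w by (simp add: shell_upd \<delta>_shell)
next
  case False
  then obtain w where w: "k w \<noteq> 0" "\<And>w. e w = 0" using dispersive by blast
  have "\<delta> w ((shell z)(Der (other w) 1 2 := s)) = \<delta> w ((shell z)(Der (other w) 1 2 := 0)) - 3 * k w * s * Dx T (shell z)" for s
    by (cases w; simp add: \<delta>_expand w(2) D_upd[simplified] algebra_simps)
  from this[of 1] show ?thesis
    using w by (simp add: shell_upd \<delta>_shell)
qed

lemma T_only_t [simp]: "d_x T = (\<lambda>_. 0)" "d_u T = (\<lambda>_. 0)" "d_v T = (\<lambda>_. 0)"
proof -
  have "d_x T p + r * d_u T p + s * d_v T p = 0" for p r s
    using T_only_t_aux[of "(over p)(Der U_var 0 1 := r, Der V_var 0 1 := s)"] by (simp add: Dx_def)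
  from this[of _ 0 0] this[of _ 1 0] this[of _ 0 1]
  show "d_x T = (\<lambda>_. 0)" "d_u T = (\<lambda>_. 0)" "d_v T = (\<lambda>_. 0)"
    by (auto simp: fun_eq_iff)
qed

lemma D_T: "Dx T z = 0" "Dxx T z = 0" "Dxxx T z = 0" "Dt T z = d_t T (base z)" "Dtx T z = 0" "Dtxx T z = 0"
  by (simp_all add: Dx_def Dt_def Dxx_def Dtx_def Dxxx_def Dtxx_def)

text \<open>The condition contains products of two second derivatives only through \<open>\<X>\<^sub>u\<close> and \<open>\<X>\<^sub>v\<close>: products of
  \<open>w\<^sub>t\<^sub>x\<close> with \<open>u\<^sub>x\<^sub>x\<close> and \<open>v\<^sub>x\<^sub>x\<close> in the term with \<open>e w\<close>, and products of \<open>w'\<^sub>x\<^sub>x\<close> with \<open>u\<^sub>x\<^sub>x\<close> and \<open>v\<^sub>x\<^sub>x\<close> in the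
  term with \<open>k w\<close>.  Second differences isolate them.\<close>

lemma X_only_tx_aux: "d_u X p = 0 \<and> d_v X p = 0"
proof -
  define y where "y = shell (over p)"
  have y: "y (Der w 0 1) = 0" "y (Der w 0 2) = 0" "y (Der w 1 1) = 0" "base y = p" for w
    by (simp_all add: y_def)
  show ?thesis
  proof (cases "\<exists>w. e w \<noteq> 0")
    case True
    then obtain w where w: "e w \<noteq> 0" by blast
    define Q where "Q w' r s = \<delta> w (y(Der w 1 1 := r, Der w' 0 2 := s))" for w' r s
    have Q0: "Q w' r s = 0" for w' r s
      by (simp add: Q_def y_def shell_upd \<delta>_shell)
    have *: "Q w' 1 1 - Q w' 1 0 - Q w' 0 1 + Q w' 0 0
        = - (if w' = w then 3 else 1) * e w * d_dep w' X p" for w'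
      unfolding Q_def
      by (cases w; cases w'; simp add: \<delta>_expand D_T D_upd[simplified] y[simplified] algebra_simps)
    have "d_dep w' X p = 0" for w'
      using *[of w'] w by (simp add: Q0 split: if_splits)
    from this[of U_var] this[of V_var] show ?thesis by simp
  next
    case False
    then obtain w where w: "k w \<noteq> 0" "\<And>w. e w = 0" using dispersive by blast
    define Q where "Q w' r s = \<delta> w (y(Der w' 0 2 := s, Der (other w) 0 2 := r))" for w' r s
    have Q0: "Q w' r s = 0" for w' r s
      by (simp add: Q_def y_def shell_upd \<delta>_shell)
    have "Q w 1 1 - Q w 1 0 - Q w 0 1 + Q w 0 0 = - 3 * k w * d_dep w X p"
      "Q w 1 0 + Q w (- 1) 0 - 2 * Q w 0 0 = - 6 * k w * d_dep (other w) X p"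
      unfolding Q_def
      by (cases w; simp add: \<delta>_expand w(2) D_T D_upd[simplified] y[simplified] algebra_simps)+
    then show ?thesis using w by (cases w) (auto simp: Q0)
  qed
qed

lemma X_only_tx [simp]: "d_u X = (\<lambda>_. 0)" "d_v X = (\<lambda>_. 0)"
  using X_only_tx_aux by (auto simp: fun_eq_iff)

lemmas [simp] = axes_commute smooth_pd

lemma D_X: "Dx X z = d_x X (base z)" "Dt X z = d_t X (base z)" "Dxx X z = d_x (d_x X) (base z)"
  "Dtx X z = d_t (d_x X) (base z)" "Dxxx X z = d_x (d_x (d_x X)) (base z)"
  "Dtxx X z = d_t (d_x (d_x X)) (base z)"
  by (simp_all add: Dx_def Dt_def Dxx_def Dtx_def Dxxx_def Dtxx_def)

text \<open>The coefficient of \<open>w'\<^sub>t\<^sub>x\<close> is \<open>e w\<close> times \<open>2 D\<^sub>x \<W>\<^bsub>w'\<^esub>\<close>, reduced by \<open>\<X>\<^sub>x\<^sub>x\<close> if \<open>w' = w\<close>; being zero for all values of \<open>u\<^sub>x\<close> and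
  \<open>v\<^sub>x\<close>, it yields three equations.\<close>

lemma affine_from_txx:
  assumes "e w \<noteq> 0"
  shows "d_u (d_dep w' (W w)) = (\<lambda>_. 0)" "d_v (d_dep w' (W w)) = (\<lambda>_. 0)"
    "d_x (d_dep w' (W w)) = (\<lambda>p. (if w' = w then 1 / 2 else 0) * d_x (d_x X) p)"
proof -
  have "2 * (d_x (d_dep w' (W w)) p + r * d_u (d_dep w' (W w)) p + s * d_v (d_dep w' (W w)) p)
      = (if w' = w then 1 else 0) * d_x (d_x X) p" for p r s
  proof -
    define y where "y = shell ((over p)(Der U_var 0 1 := r, Der V_var 0 1 := s))"
    have y: "y (Der w 1 1) = 0" "base y = p" "y (Der U_var 0 1) = r" "y (Der V_var 0 1) = s" for w
      by (simp_all add: y_def)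
    have "\<delta> w (y(Der w' 1 1 := 1)) - \<delta> w (y(Der w' 1 1 := 0))
        = e w * (2 * Dx (d_dep w' (W w)) y - (if w' = w then 1 else 0) * d_x (d_x X) p)"
      by (cases w; cases w'; simp add: \<delta>_expand D_T D_X D_upd[simplified] y[simplified] algebra_simps)
    moreover have "\<delta> w (y(Der w' 1 1 := i)) = 0" for i
      by (simp add: y_def shell_upd \<delta>_shell)
    ultimately have "2 * Dx (d_dep w' (W w)) y - (if w' = w then 1 else 0) * d_x (d_x X) p = 0"
      using assms by simp
    then show ?thesis
      by (simp add: Dx_def y[simplified] split: if_splits)
  qed
  from this[of _ 0 0] this[of _ 1 0] this[of _ 0 1]
  show "d_u (d_dep w' (W w)) = (\<lambda>_. 0)" "d_v (d_dep w' (W w)) = (\<lambda>_. 0)"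
    "d_x (d_dep w' (W w)) = (\<lambda>p. (if w' = w then 1 / 2 else 0) * d_x (d_x X) p)"
    by (auto simp: fun_eq_iff field_simps)
qed

lemma e_Dt: "e w * Dt (d_dep w' (W w)) z = e w * d_t (d_dep w' (W w)) (base z)"
  using affine_from_txx[of w w'] by (cases "e w = 0") (simp_all add: Dt_def)

text \<open>The coefficient of \<open>w'\<^sub>x\<^sub>x\<close> at a jet with \<open>u\<^sub>x = r\<close> and \<open>v\<^sub>x = s\<close>.\<close>

lemma affine_from_xxx_aux:
  assumes "k w \<noteq> 0"
  shows "e w * (d_t (d_dep w' (W w)) p - (if w' = w then 2 else 0) * d_t (d_x X) p)
    + 3 * k w * (d_x (d_dep w' (W (other w))) p - (if w' = w then 0 else 1) * d_x (d_x X) p)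
    + 3 * k w * (r * d_u (d_dep w' (W (other w))) p + s * d_v (d_dep w' (W (other w))) p) = 0"
proof -
  define y where "y = shell ((over p)(Der U_var 0 1 := r, Der V_var 0 1 := s))"
  have y: "y (Der w 0 2) = 0" "base y = p" "y (Der U_var 0 1) = r" "y (Der V_var 0 1) = s" for w
    by (simp_all add: y_def)
  have "\<delta> w (y(Der w' 0 2 := 1)) - \<delta> w (y(Der w' 0 2 := 0))
      = (e w * Dt (d_dep w' (W w)) y - (if w' = w then 2 else 0) * e w * d_t (d_x X) p)
        + k w * (3 * Dx (d_dep w' (W (other w))) y - (if w' = w then 0 else 3) * d_x (d_x X) p)"
    by (cases w; cases w'; simp add: \<delta>_expand D_T D_X D_upd[simplified] y[simplified] algebra_simps)
  moreover have "\<delta> w (y(Der w' 0 2 := i)) = 0" for i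
    by (simp add: y_def shell_upd \<delta>_shell)
  ultimately show ?thesis
    by (simp add: e_Dt Dx_def y[simplified] algebra_simps split: if_splits)
qed

lemma affine_from_xxx:
  assumes "k w \<noteq> 0"
  shows "d_u (d_dep w' (W (other w))) = (\<lambda>_. 0)" "d_v (d_dep w' (W (other w))) = (\<lambda>_. 0)"
    "e w * (d_t (d_dep w' (W w)) p - (if w' = w then 2 else 0) * d_t (d_x X) p)
      + 3 * k w * (d_x (d_dep w' (W (other w))) p - (if w' = w then 0 else 1) * d_x (d_x X) p) = 0"
proof -
  show *: "e w * (d_t (d_dep w' (W w)) p - (if w' = w then 2 else 0) * d_t (d_x X) p)
      + 3 * k w * (d_x (d_dep w' (W (other w))) p - (if w' = w then 0 else 1) * d_x (d_x X) p) = 0" for p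
    using affine_from_xxx_aux[OF assms, of w' p 0 0] by simp
  have "r * d_u (d_dep w' (W (other w))) p + s * d_v (d_dep w' (W (other w))) p = 0" for p r s
    using affine_from_xxx_aux[OF assms, of w' p r s] * assms by (metis add_0 mult_eq_0_iff zero_neq_numeral)
  from this[of 1 _ 0] this[of 0 _ 1]
  show "d_u (d_dep w' (W (other w))) = (\<lambda>_. 0)" "d_v (d_dep w' (W (other w))) = (\<lambda>_. 0)"
    by (auto simp: fun_eq_iff)
qed

text \<open>The factor \<open>e w\<close> carries the case distinction: either it is zero, or \<open>\<W>\<close> is affine by
  \<open>affine_from_txx\<close>.\<close>

lemma e_Dtxx:
  "e w * Dtxx (W w) z = e w * (d_t (d_x (d_x (W w))) (base z)
     + z (Der w 1 0) * d_x (d_x (d_x X)) (base z) / 2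
     + z (Der w 0 1) * d_t (d_x (d_x X)) (base z) + z (Der w 1 1) * d_x (d_x X) (base z)
     + z (Der U_var 0 2) * d_t (d_u (W w)) (base z) + z (Der V_var 0 2) * d_t (d_v (W w)) (base z)
     + z (Der U_var 1 2) * d_u (W w) (base z) + z (Der V_var 1 2) * d_v (W w) (base z))"
proof (cases "e w = 0")
  case False
  show ?thesis
    using affine_from_txx[OF False, of U_var] affine_from_txx[OF False, of V_var]
    by (cases w) (simp_all add: Dtxx_def Dtx_def Dx_def Dt_def algebra_simps)
qed simp

lemma k_Dxxx:
  fixes z w defines "g \<equiv> W (other w)"
  shows "k w * Dxxx g z = k w * (d_x (d_x (d_x g)) (base z)
     + 3 * z (Der U_var 0 1) * d_x (d_x (d_u g)) (base z) + 3 * z (Der V_var 0 1) * d_x (d_x (d_v g)) (base z)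
     + 3 * z (Der U_var 0 2) * d_x (d_u g) (base z) + 3 * z (Der V_var 0 2) * d_x (d_v g) (base z)
     + z (Der U_var 0 3) * d_u g (base z) + z (Der V_var 0 3) * d_v g (base z))"
proof (cases "k w = 0")
  case False
  show ?thesis
    using affine_from_xxx(1,2)[OF False, of U_var] affine_from_xxx(1,2)[OF False, of V_var] smW[of "other w"]
    by (simp add: g_def Dxxx_def Dxx_def Dx_def algebra_simps)
qed simp

text \<open>Since \<^const>\<open>on_shell\<close> is affine in the derivatives, the condition on solutions is now affine in the
  free coordinates, and each remaining coefficient is a single difference.\<close>

lemma \<delta>_reduced:
  defines "\<tau> \<equiv> d_t T" and "R \<equiv> d_x X" and "G \<equiv> d_t X"
  fixes w z defines "f \<equiv> W w" and "g \<equiv> W (other w)" and "p \<equiv> base z"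
  shows "\<delta> w z = Dt f z - z (Der w 1 0) * \<tau> p - z (Der w 0 1) * G p
    + (case w of
         U_var \<Rightarrow> (a + b) * (V p * z (Der U_var 0 1) + z (Der V_var 0 0) * (Dx U z - z (Der U_var 0 1) * R p))
           + a * U p * z (Der V_var 0 1)
           + (a * z (Der U_var 0 0) + c) * (Dx V z - z (Der V_var 0 1) * R p)
       | V_var \<Rightarrow> b * U p * z (Der U_var 0 1)
           + (b * z (Der U_var 0 0) + c) * (Dx U z - z (Der U_var 0 1) * R p)
           + (a + b) * (V p * z (Der V_var 0 1) + z (Der V_var 0 0) * (Dx V z - z (Der V_var 0 1) * R p)))
    + e w * (d_t (d_x (d_x f)) p + z (Der w 1 0) * d_x (d_x R) p / 2
       + z (Der U_var 0 2) * d_t (d_u f) p + z (Der V_var 0 2) * d_t (d_v f) p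
       + z (Der U_var 1 2) * d_u f p + z (Der V_var 1 2) * d_v f p
       - z (Der w 1 2) * (\<tau> p + 2 * R p) - 2 * z (Der w 0 2) * d_t R p - z (Der w 0 3) * G p)
    + k w * (d_x (d_x (d_x g)) p
       + 3 * z (Der U_var 0 1) * d_x (d_x (d_u g)) p + 3 * z (Der V_var 0 1) * d_x (d_x (d_v g)) p
       + 3 * z (Der U_var 0 2) * d_x (d_u g) p + 3 * z (Der V_var 0 2) * d_x (d_v g) p
       + z (Der U_var 0 3) * d_u g p + z (Der V_var 0 3) * d_v g p
       - 3 * z (Der (other w) 0 3) * R p - 3 * z (Der (other w) 0 2) * d_x R p
       - z (Der (other w) 0 1) * d_x (d_x R) p)"
  unfolding \<delta>_expand D_T D_X right_diff_distrib[of "e w"] right_diff_distrib[of "k w"] e_Dtxx k_Dxxx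
    assms
  by (simp add: algebra_simps split: dep_var.split)

lemma coefficient_w_txx: "e w * (4 * d_x X p + e w * d_x (d_x (d_x X)) p) = 0"
  and coefficient_other_txx: "(e w - e (other w)) * d_dep (other w) (W w) p = 0"
  and coefficient_other_xxx: "k w * (d_dep (other w) (W (other w)) p - d_dep w (W w) p + d_t T p - 3 * d_x X p
      - e w * d_x (d_x (d_x X)) p / 2) = 0"
proof -
  define z where "z = over p"
  have z: "base z = p" "i \<noteq> 0 \<or> j \<noteq> 0 \<Longrightarrow> z (Der w i j) = 0" for w i j
    by (simp_all add: z_def)
  note [simp] = \<delta>_reduced Dt_def Dx_def z
  have "\<delta> w (shell (z(Der w 1 2 := 1))) - \<delta> w (shell z)
      = - (1 / 2) * (e w * (4 * d_x X p + e w * d_x (d_x (d_x X)) p))"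
    by (cases w; simp add: algebra_simps)
  then show "e w * (4 * d_x X p + e w * d_x (d_x (d_x X)) p) = 0"
    by (simp add: \<delta>_shell del: \<delta>_reduced)
  have "\<delta> w (shell (z(Der (other w) 1 2 := 1))) - \<delta> w (shell z)
      = (e w - e (other w)) * d_dep (other w) (W w) p"
    by (cases w; simp add: algebra_simps)
  then show "(e w - e (other w)) * d_dep (other w) (W w) p = 0"
    by (simp add: \<delta>_shell del: \<delta>_reduced)
  have "\<delta> w (shell (z(Der (other w) 0 3 := 1))) - \<delta> w (shell z)
      = k w * (d_dep (other w) (W (other w)) p - d_dep w (W w) p + d_t T p - 3 * d_x X p
      - e w * d_x (d_x (d_x X)) p / 2)"
    by (cases w; simp add: algebra_simps)
  then show "k w * (d_dep (other w) (W (other w)) p - d_dep w (W w) p + d_t T p - 3 * d_x X p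
      - e w * d_x (d_x (d_x X)) p / 2) = 0"
    by (simp add: \<delta>_shell del: \<delta>_reduced)
qed

lemma jet_free_terms:
  fixes p defines "u \<equiv> fst (snd (snd p))" and "v \<equiv> snd (snd (snd p))"
  shows "d_t U p + (a + b) * v * d_x U p + (a * u + c) * d_x V p
      + e U_var * d_t (d_x (d_x U)) p + k U_var * d_x (d_x (d_x V)) p = 0"
    and "d_t V p + (b * u + c) * d_x U p + (a + b) * v * d_x V p
      + e V_var * d_t (d_x (d_x V)) p + k V_var * d_x (d_x (d_x U)) p = 0"
  using \<delta>_shell[of U_var "over p"] \<delta>_shell[of V_var "over p"]
  by (simp_all add: \<delta>_reduced Dt_def Dx_def u_def v_def algebra_simps)

text \<open>The coefficients of \<open>u\<^sub>x\<close> and \<open>v\<^sub>x\<close> in both equations.  Terms with \<open>e\<close> come from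
  \<open>w\<^sub>t \<W>\<^sub>x\<^sub>x\<^sub>w\<close> with \<open>w\<^sub>t\<close> expressed through the first derivatives.\<close>

lemma first_order_coefficients:
  fixes p defines "u \<equiv> fst (snd (snd p))" and "v \<equiv> snd (snd (snd p))"
    and "\<tau> \<equiv> d_t T p" and "R \<equiv> d_x X p" and "R2 \<equiv> d_x (d_x (d_x X)) p"
  shows first_eq_ux: "(a * u + c) * d_u V p - (b * u + c) * d_v U p + (a + b) * v * (\<tau> - R - e U_var * R2 / 2)
      - d_t X p + (a + b) * V p + 3 * k U_var * d_x (d_x (d_u V)) p = 0"
    and second_eq_ux: "(b * u + c) * (d_u U p - d_v V p + \<tau> - R - e V_var * R2 / 2) + b * U p
      + k V_var * (3 * d_x (d_x (d_u U)) p - R2) = 0"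
    and first_eq_vx: "(a * u + c) * (d_v V p - d_u U p + \<tau> - R - e U_var * R2 / 2) + a * U p
      + k U_var * (3 * d_x (d_x (d_v V)) p - R2) = 0"
    and second_eq_vx: "(b * u + c) * d_v U p - (a * u + c) * d_u V p + (a + b) * v * (\<tau> - R - e V_var * R2 / 2)
      - d_t X p + (a + b) * V p + 3 * k V_var * d_x (d_x (d_v U)) p = 0"
proof -
  define z where "z = over p"
  have z: "base z = p" "z (Der U_var 0 0) = u" "z (Der V_var 0 0) = v"
    "i \<noteq> 0 \<or> j \<noteq> 0 \<Longrightarrow> z (Der w i j) = 0" for w i j
    by (simp_all add: z_def u_def v_def)
  note [simp] = \<delta>_reduced Dt_def Dx_def z
  have "\<delta> U_var (shell (z(Der U_var 0 1 := 1))) - \<delta> U_var (shell z) =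
     (a * u + c) * d_u V p - (b * u + c) * d_v U p + (a + b) * v * (\<tau> - R - e U_var * R2 / 2)
      - d_t X p + (a + b) * V p + 3 * k U_var * d_x (d_x (d_u V)) p"
    by (simp add: \<tau>_def R_def R2_def field_simps)
  then show "(a * u + c) * d_u V p - (b * u + c) * d_v U p + (a + b) * v * (\<tau> - R - e U_var * R2 / 2)
      - d_t X p + (a + b) * V p + 3 * k U_var * d_x (d_x (d_u V)) p = 0"
    by (simp add: \<delta>_shell del: \<delta>_reduced)
  have "\<delta> V_var (shell (z(Der U_var 0 1 := 1))) - \<delta> V_var (shell z) =
     (b * u + c) * (d_u U p - d_v V p + \<tau> - R - e V_var * R2 / 2) + b * U p
      + k V_var * (3 * d_x (d_x (d_u U)) p - R2)"
    by (simp add: \<tau>_def R_def R2_def field_simps)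
  then show "(b * u + c) * (d_u U p - d_v V p + \<tau> - R - e V_var * R2 / 2) + b * U p
      + k V_var * (3 * d_x (d_x (d_u U)) p - R2) = 0"
    by (simp add: \<delta>_shell del: \<delta>_reduced)
  have "\<delta> U_var (shell (z(Der V_var 0 1 := 1))) - \<delta> U_var (shell z) =
     (a * u + c) * (d_v V p - d_u U p + \<tau> - R - e U_var * R2 / 2) + a * U p
      + k U_var * (3 * d_x (d_x (d_v V)) p - R2)"
    by (simp add: \<tau>_def R_def R2_def field_simps)
  then show "(a * u + c) * (d_v V p - d_u U p + \<tau> - R - e U_var * R2 / 2) + a * U p
      + k U_var * (3 * d_x (d_x (d_v V)) p - R2) = 0"
    by (simp add: \<delta>_shell del: \<delta>_reduced)
  have "\<delta> V_var (shell (z(Der V_var 0 1 := 1))) - \<delta> V_var (shell z) =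
     (b * u + c) * d_v U p - (a * u + c) * d_u V p + (a + b) * v * (\<tau> - R - e V_var * R2 / 2)
      - d_t X p + (a + b) * V p + 3 * k V_var * d_x (d_x (d_v U)) p"
    by (simp add: \<tau>_def R_def R2_def field_simps)
  then show "(b * u + c) * d_v U p - (a * u + c) * d_u V p + (a + b) * v * (\<tau> - R - e V_var * R2 / 2)
      - d_t X p + (a + b) * V p + 3 * k V_var * d_x (d_x (d_v U)) p = 0"
    by (simp add: \<delta>_shell del: \<delta>_reduced)
qed

section \<open>Solving the determining equations\<close>

abbreviation (input) "\<tau> \<equiv> d_t T"
abbreviation (input) "R \<equiv> d_x X"

text \<open>Differentiating the first equation by \<open>u\<close> gives \<open>(a u + c) \<U>\<^sub>u\<^sub>u = 0\<close>, hence \<open>\<U>\<^sub>u\<^sub>u = 0\<close>; then the second one,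
  differentiated by \<open>u\<close>, determines \<open>\<U>\<^sub>u\<close> unless \<open>b = 0\<close>.\<close>

lemma U_linear:
  assumes s: "smooth r" "d_u r = (\<lambda>_. 0)" "smooth s" "d_u s = (\<lambda>_. 0)"
    and first: "\<And>p. a * U p = (a * fst (snd (snd p)) + c) * d_u U p + r p"
    and second: "\<And>p. b * U p = (b * fst (snd (snd p)) + c) * (2 * (R p - \<tau> p) - d_u U p) + s p"
    and c: "c \<noteq> 0"
  shows "b * (d_u U p - (R p - \<tau> p)) = 0"
proof -
  have "d_u (\<lambda>p. a * U p) p = d_u (\<lambda>p. (a * fst (snd (snd p)) + c) * d_u U p + r p) p" for p
    by (simp only: first)
  then have "(a * fst (snd (snd p)) + c) * d_u (d_u U) p = 0" for p
    by (simp add: s algebra_simps)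
  then have uu: "d_u (d_u U) = (\<lambda>_. 0)"
    by (intro affine_factor_cancel[OF _ c]) simp_all
  have "d_u (\<lambda>p. b * U p) p
      = d_u (\<lambda>p. (b * fst (snd (snd p)) + c) * (2 * (R p - \<tau> p) - d_u U p) + s p) p"
    by (simp only: second)
  then show ?thesis
    by (simp add: s uu algebra_simps)
qed

text \<open>In the sum of the coefficient of \<open>u\<^sub>x\<close> in the first equation and that of \<open>v\<^sub>x\<close> in the second,
  \<open>\<U>\<^sub>v\<close> and \<open>\<V>\<^sub>u\<close> cancel, which gives \<open>\<V>\<close>; then \<open>\<V>\<^sub>u = 0\<close>, and \<open>\<U>\<^sub>v = 0\<close> follows.  That
  \<open>\<X>\<^sub>x\<^sub>x = 0\<close> comes from the dispersive terms: according to which of \<open>b\<close>, \<open>\<kappa>\<close>, \<open>\<lambda>\<close> vanish, either \<open>\<X>\<^sub>x\<close> is a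
  multiple of \<open>\<T>\<^sub>t\<close>, which does not depend on \<open>x\<close>, or two expressions for \<open>\<U>\<^sub>x\<^sub>u\<close> disagree unless
  \<open>\<X>\<^sub>x\<^sub>x = 0\<close>.\<close>

lemma determining_e_zero:
  assumes Ac: "(a + b) * c \<noteq> 0" and e: "\<And>w. e w = 0"
  shows "d_x R = (\<lambda>_. 0)" (is ?C1)
    and "(a + b) * V p = d_t X p - (a + b) * snd (snd (snd p)) * (\<tau> p - R p)"
    and "a * U p = (a * fst (snd (snd p)) + c) * d_u U p"
    and "b * U p = (b * fst (snd (snd p)) + c) * (2 * (R p - \<tau> p) - d_u U p)"
proof -
  have A: "a + b \<noteq> 0" and c: "c \<noteq> 0" using Ac by auto
  have kx: "d_x (d_dep w' (W (other w))) = (\<lambda>p. (if w' = w then 0 else 1) * d_x R p)" if "k w \<noteq> 0" for w w'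
    using affine_from_xxx(3)[OF that, of w'] that by (simp add: e fun_eq_iff)
  have kU: "k U_var * d_x (d_x (d_u V)) p = 0" "k U_var * d_x (d_x (d_v V)) p = k U_var * d_x (d_x R) p" for p
    using kx[of U_var U_var] kx[of U_var V_var] by (cases "k U_var = 0"; simp)+
  have kV: "k V_var * d_x (d_x (d_v U)) p = 0" "k V_var * d_x (d_x (d_u U)) p = k V_var * d_x (d_x R) p" for p
    using kx[of V_var V_var] kx[of V_var U_var] by (cases "k V_var = 0"; simp)+
  have C2: "(a + b) * V p = d_t X p - (a + b) * snd (snd (snd p)) * (\<tau> p - R p)" for p
    using first_eq_ux[of p, simplified e] second_eq_vx[of p, simplified e] kU(1)[of p] kV(1)[of p] by algebra
  have V': "V = (\<lambda>p. 1 / (a + b) * d_t X p - snd (snd (snd p)) * (\<tau> p - R p))"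
    using C2 A by (auto simp: fun_eq_iff field_simps)
  have dV: "d_u V p = 0" "d_v V p = R p - \<tau> p" for p
    unfolding V' by simp_all
  have "(b * fst (snd (snd p)) + c) * d_v U p = 0" for p
    using first_eq_ux[of p, simplified e] C2[of p] kU(1)[of p] dV(1)[of p] by algebra
  then have Uv: "d_v U = (\<lambda>_. 0)"
    by (intro affine_factor_cancel[OF _ c]) simp_all
  have first': "a * U p = (a * fst (snd (snd p)) + c) * d_u U p + - 2 * k U_var * d_x (d_x R) p" for p
    using first_eq_vx[of p, simplified e dV] kU(2)[of p] by algebra
  have second': "b * U p = (b * fst (snd (snd p)) + c) * (2 * (R p - \<tau> p) - d_u U p) + - 2 * k V_var * d_x (d_x R) p" for p
    using second_eq_ux[of p, simplified e dV] kV(2)[of p] by algebra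
  have Uu: "b * (d_u U p - (R p - \<tau> p)) = 0" for p
    by (rule U_linear[OF _ _ _ _ first' second' c]) simp_all
  have kkU: "k U_var \<noteq> 0 \<Longrightarrow> d_u U p = - 2 * R p" for p
    using coefficient_other_xxx[of U_var p] by (simp add: e dV)
  have kkV: "k V_var \<noteq> 0 \<Longrightarrow> d_u U p = 4 * R p - 2 * \<tau> p" for p
    using coefficient_other_xxx[of V_var p] by (simp add: e dV)
  have R_if: "d_x R p = 0" if "\<And>p. m * \<tau> p = R p" for m p
  proof -
    have "d_x R p = d_x (\<lambda>p. m * \<tau> p) p" by (simp only: that)
    then show ?thesis by simp
  qed
  show C1: ?C1
  proof
    fix p
    show "d_x R p = 0"
    proof (cases "b = 0")
      case False
      then have u: "d_u U p = R p - \<tau> p" for p using Uu[of p] by simp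
      obtain w where "k w \<noteq> 0" using dispersive e by blast
      then have "1 / 3 * \<tau> p = R p" for p
        using kkU[of p] kkV[of p] u[of p] by (cases w) simp_all
      then show ?thesis by (rule R_if)
    next
      case b: True
      show ?thesis
      proof (cases "k V_var = 0")
        case True
        then have "k U_var \<noteq> 0" using dispersive e dep_var.exhaust by metis
        then have "1 / 2 * \<tau> p = R p" for p
          using second'[of p] kkU[of p] c b True by simp
        then show ?thesis by (rule R_if)
      next
        case False
        have x: "d_x (d_u U) p = d_x R p"
          using kx[OF False, of U_var] by simp
        have uU: "d_u U = (\<lambda>p. 4 * R p - 2 * \<tau> p)"
          using kkV[OF False] by auto
        have "d_x (d_u U) p = 4 * d_x R p"
          unfolding uU by simp
        with x show ?thesis by simp
      qed
    qed
  qed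
  show "(a + b) * V p = d_t X p - (a + b) * snd (snd (snd p)) * (\<tau> p - R p)"
    by (rule C2)
  show "a * U p = (a * fst (snd (snd p)) + c) * d_u U p"
    "b * U p = (b * fst (snd (snd p)) + c) * (2 * (R p - \<tau> p) - d_u U p)"
    using first'[of p] second'[of p] by (simp_all add: C1)
qed

text \<open>A mixed dispersive term forbids rescaling of \<open>x\<close>, but its own coefficient only yields
  \<open>4 \<X>\<^sub>x + e \<X>\<^sub>x\<^sub>x\<^sub>x = 0\<close>, which has exponential and trigonometric solutions.  They are excluded by comparing
  \<open>\<V>\<^sub>v\<close>, as computed from the first-order terms, with the information on \<open>\<V>\<^sub>v\<close> from the second
  equation: \<open>2 \<V>\<^sub>x\<^sub>v = \<X>\<^sub>x\<^sub>x\<close> if that equation has a mixed dispersive term, and the coefficient of \<open>v\<^sub>x\<close>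
  otherwise.\<close>

lemma determining_e_nonzero:
  assumes Ac: "(a + b) * c \<noteq> 0" and e: "e w0 \<noteq> 0"
  shows "R = (\<lambda>_. 0)" (is ?C1)
    and "(a + b) * V p = d_t X p - (a + b) * snd (snd (snd p)) * (\<tau> p - R p)"
    and "a * U p = (a * fst (snd (snd p)) + c) * d_u U p"
    and "b * U p = (b * fst (snd (snd p)) + c) * (2 * (R p - \<tau> p) - d_u U p)"
proof -
  have A: "a + b \<noteq> 0" and c: "c \<noteq> 0" using Ac by auto
  define R2 where "R2 = d_x (d_x R)"
  have [simp]: "smooth R2" "d_u R2 = (\<lambda>_. 0)" "d_v R2 = (\<lambda>_. 0)" by (simp_all add: R2_def)
  \<comment> \<open>These terms do not depend on \<open>u\<close> and \<open>v\<close>, so they drop out of the derivatives of \<open>V\<close> by \<open>u\<close> and \<open>v\<close>.\<close>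
  have mixed: "\<exists>m. \<forall>p. k w * d_x (d_x (d_dep w (W (other w)))) p = m * d_t (d_x R) p" for w
  proof (cases "k w = 0")
    case True
    then show ?thesis by (intro exI[of _ 0]) simp
  next
    case False
    show ?thesis
    proof (cases "e w = 0")
      case True
      then have "d_x (d_dep w (W (other w))) = (\<lambda>_. 0)"
        using affine_from_xxx(3)[OF False, of w] False by (simp add: fun_eq_iff)
      then show ?thesis by (intro exI[of _ 0]) simp
    next
      case e: False
      have g: "d_x (d_dep w (W (other w))) = (\<lambda>p. - (e w / (3 * k w)) * (d_t (d_dep w (W w)) p - 2 * d_t R p))"
      proof
        fix p
        show "d_x (d_dep w (W (other w))) p = - (e w / (3 * k w)) * (d_t (d_dep w (W w)) p - 2 * d_t R p)"
          using affine_from_xxx(3)[OF False, of w p] False by (simp add: field_simps)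
      qed
      have "d_x (d_t (d_dep w (W w))) = d_t (d_x (d_dep w (W w)))"
        by (rule axes_commute) simp
      also have "d_x (d_dep w (W w)) = (\<lambda>p. 1 / 2 * d_x R p)"
        using affine_from_txx(3)[OF e, of w] by simp
      finally have "d_x (d_t (d_dep w (W w))) = (\<lambda>p. 1 / 2 * d_t (d_x R) p)"
        by simp
      then have "d_x (d_x (d_dep w (W (other w)))) p
          = - (e w / (3 * k w)) * (1 / 2 * d_t (d_x R) p - 2 * d_t (d_x R) p)" for p
        unfolding g by simp
      then have "k w * d_x (d_x (d_dep w (W (other w)))) p = e w / 2 * d_t (d_x R) p" for p
        using False by (simp add: field_simps)
      then show ?thesis by blast
    qed
  qed
  obtain mU where mU: "\<And>p. k U_var * d_x (d_x (d_u V)) p = mU * d_t (d_x R) p"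
    using mixed[of U_var] by auto
  obtain mV where mV: "\<And>p. k V_var * d_x (d_x (d_v U)) p = mV * d_t (d_x R) p"
    using mixed[of V_var] by auto
  have AV: "(a + b) * V p = d_t X p - (a + b) * snd (snd (snd p)) * (\<tau> p - R p - (e U_var + e V_var) * R2 p / 4)
      - 3 / 2 * (mU + mV) * d_t (d_x R) p" for p
    using first_eq_ux[of p] second_eq_vx[of p] mU[of p] mV[of p] by (simp add: R2_def field_simps)
  then have V': "(\<lambda>p. (a + b) * V p) = (\<lambda>p. d_t X p
      - (a + b) * snd (snd (snd p)) * (\<tau> p - R p - (e U_var + e V_var) * R2 p / 4)
      - 3 / 2 * (mU + mV) * d_t (d_x R) p)"
    by auto
  have uV: "d_u V = (\<lambda>_. 0)"
    using arg_cong[OF V', of d_u] A by (simp add: fun_eq_iff)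
  have "(a + b) * d_v V p = (a + b) * (- (\<tau> p - R p - (e U_var + e V_var) / 4 * R2 p))" for p
    using arg_cong[OF V', of "\<lambda>f. d_v f p"] by (simp add: algebra_simps)
  then have vV: "d_v V = (\<lambda>p. - (\<tau> p - R p - (e U_var + e V_var) / 4 * R2 p))"
    using A by (simp only: mult_cancel_left) auto
  have eR: "e w \<noteq> 0 \<Longrightarrow> e w * R2 p = - 4 * R p" for w p
    using coefficient_w_txx[of w p] by (simp add: R2_def)
  have R0: "R = (\<lambda>_. 0)"
  proof (cases "e V_var = 0")
    case False
    have x: "d_x (d_v V) p = 1 / 2 * d_x R p" for p
      using affine_from_txx(3)[OF False, of V_var] by simp
    \<comment> \<open>\<open>m\<close> counts the nonzero ones among \<open>e U_var\<close> and \<open>e V_var\<close>.\<close>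
    have "\<exists>m \<in> {1, 2}. \<forall>p. (e U_var + e V_var) / 4 * R2 p = - m * R p"
    proof (cases "e U_var = 0")
      case True
      then show ?thesis using eR[OF False] by (intro bexI[of _ 1]) (auto simp: field_simps)
    next
      case U: False
      then show ?thesis using eR[OF False] eR[OF U] by (intro bexI[of _ 2]) (auto simp: field_simps)
    qed
    then obtain m where m: "m \<in> {1, 2}" and mR: "\<And>p. (e U_var + e V_var) / 4 * R2 p = - m * R p"
      by blast
    have vV': "d_v V = (\<lambda>p. (1 - m) * R p - \<tau> p)"
      unfolding vV mR by (simp add: algebra_simps)
    have "d_x (d_v V) p = (1 - m) * d_x R p" for p
      unfolding vV' by simp
    then have "d_x R p = 0" for p
      using x[of p] m by auto
    then have "d_x R = (\<lambda>_. 0)" by (rule ext)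
    then have "R2 = (\<lambda>_. 0)" by (simp add: R2_def)
    then show ?thesis using eR[OF False] by auto
  next
    case V0: True
    then have U: "e U_var \<noteq> 0" using e by (cases w0) auto
    have vU: "d_v U = (\<lambda>_. 0)"
      using coefficient_other_txx[of U_var] U V0 by auto
    have "(a + b) * V p = d_t X p - (a + b) * snd (snd (snd p)) * (\<tau> p - R p)" for p
      using second_eq_vx[of p] V0 by (simp add: vU uV algebra_simps)
    then have *: "V = (\<lambda>p. 1 / (a + b) * d_t X p - snd (snd (snd p)) * (\<tau> p - R p))"
      using A by (auto simp: fun_eq_iff field_simps)
    have "d_v V p = - (\<tau> p - R p)" for p
      unfolding * by simp
    then show ?thesis
      using eR[OF U] fun_cong[OF vV] V0 by (auto simp: fun_eq_iff)
  qed
  then have R20: "R2 = (\<lambda>_. 0)" by (simp add: R2_def)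
  have C2: "(a + b) * V p = d_t X p - (a + b) * snd (snd (snd p)) * (\<tau> p - R p)" for p
    using AV[of p] by (simp add: R20 R0)
  have vV0: "d_v V = (\<lambda>p. - \<tau> p)"
    unfolding vV by (simp add: R20 R0)
  have xvV: "d_x (d_v V) = (\<lambda>_. 0)"
    unfolding vV0 by simp
  have "k V_var * (d_u U p + 2 * \<tau> p) = 0" for p
    using coefficient_other_xxx[of V_var p] by (simp add: R0 vV0 add.commute)
  then have "d_u U p + 2 * \<tau> p = 0" if "k V_var \<noteq> 0" for p
    using that by simp
  then have "k V_var \<noteq> 0 \<Longrightarrow> d_u U = (\<lambda>p. - 2 * \<tau> p)"
    by (intro ext) (simp add: eq_neg_iff_add_eq_0)
  then have "k V_var \<noteq> 0 \<Longrightarrow> d_x (d_u U) = (\<lambda>_. 0)"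
    by simp
  then have kV: "k V_var * d_x (d_x (d_u U)) p = 0" for p
    by (cases "k V_var = 0") simp_all
  show "R = (\<lambda>_. 0)" by (rule R0)
  show "(a + b) * V p = d_t X p - (a + b) * snd (snd (snd p)) * (\<tau> p - R p)"
    by (rule C2)
  show "a * U p = (a * fst (snd (snd p)) + c) * d_u U p"
    using first_eq_vx[of p] by (simp add: R0 xvV vV0 algebra_simps)
  show "b * U p = (b * fst (snd (snd p)) + c) * (2 * (R p - \<tau> p) - d_u U p)"
    using second_eq_ux[of p, simplified R0 vV0 pd_const] kV[of p] fun_cong[OF R0, of p] by algebra
qed

lemma determining_reduced:
  assumes Ac: "(a + b) * c \<noteq> 0"
  shows "d_x R = (\<lambda>_. 0)"
    and "(a + b) * V p = d_t X p - (a + b) * snd (snd (snd p)) * (\<tau> p - R p)"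
    and "a * U p = (a * fst (snd (snd p)) + c) * d_u U p"
    and "b * U p = (b * fst (snd (snd p)) + c) * (2 * (R p - \<tau> p) - d_u U p)"
proof -
  have "d_x R = (\<lambda>_. 0) \<and>
    (a + b) * V p = d_t X p - (a + b) * snd (snd (snd p)) * (\<tau> p - R p) \<and>
    a * U p = (a * fst (snd (snd p)) + c) * d_u U p \<and>
    b * U p = (b * fst (snd (snd p)) + c) * (2 * (R p - \<tau> p) - d_u U p)"
  proof (cases "\<exists>w. e w \<noteq> 0")
    case True
    then obtain w where "e w \<noteq> 0" by blast
    note * = determining_e_nonzero[OF Ac this]
    have "d_x R = (\<lambda>_. 0)" by (simp add: *(1))
    with *(2-4) show ?thesis by blast
  next
    case False
    then have "e w = 0" for w by blast
    from determining_e_zero[OF Ac this] show ?thesis by blast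
  qed
  then show "d_x R = (\<lambda>_. 0)"
    "(a + b) * V p = d_t X p - (a + b) * snd (snd (snd p)) * (\<tau> p - R p)"
    "a * U p = (a * fst (snd (snd p)) + c) * d_u U p"
    "b * U p = (b * fst (snd (snd p)) + c) * (2 * (R p - \<tau> p) - d_u U p)"
    by blast+
qed

text \<open>The two equations for \<open>\<U>\<close> combine to \<open>(a + b) \<U> = 2 (\<X>\<^sub>x - \<T>\<^sub>t) (a u + c)\<close>.  For \<open>b \<noteq> 0\<close> they read
  \<open>a \<U> = (a u + c) q\<close> and \<open>b \<U> = (b u + c) q\<close> with \<open>q = \<X>\<^sub>x - \<T>\<^sub>t\<close>, and are compatible only if
  \<open>(a - b) q = 0\<close>.  The free terms then force \<open>\<X>\<^sub>t\<^sub>x\<close>, \<open>\<T>\<^sub>t\<^sub>t\<close> and \<open>\<X>\<^sub>t\<^sub>t\<close> to vanish.\<close>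

lemma generator_normal_form:
  assumes Ac: "(a + b) * c \<noteq> 0"
  obtains \<alpha> \<beta> s g r where "vf T X W = (\<lambda>(t, x, u, v).
    (s + (a + b) * \<alpha> * t, r + (a + b) * g * t + (a + b) * \<beta> * x,
     2 * (\<beta> - \<alpha>) * (a * u + c), g + (a + b) * (\<beta> - \<alpha>) * v))"
proof -
  note C1 = determining_reduced(1)[OF Ac] and C2 = determining_reduced(2)[OF Ac]
    and first = determining_reduced(3)[OF Ac] and second = determining_reduced(4)[OF Ac]
  have A: "a + b \<noteq> 0" and c: "c \<noteq> 0" using Ac by auto
  have Uu: "b * (d_u U p - (R p - \<tau> p)) = 0" for p
    by (rule U_linear[of "\<lambda>_. 0" "\<lambda>_. 0"]) (simp_all add: first second c)
  have U: "(a + b) * U p = 2 * (R p - \<tau> p) * (a * fst (snd (snd p)) + c)" for p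
  proof (cases "b = 0")
    case True
    then have "d_u U p = 2 * (R p - \<tau> p)"
      using second[of p] c by simp
    then show ?thesis
      using first[of p] True by algebra
  next
    case False
    then have u: "d_u U p = R p - \<tau> p" using Uu[of p] by simp
    have *: "a * U p = (a * fst (snd (snd p)) + c) * (R p - \<tau> p)"
      "b * U p = (b * fst (snd (snd p)) + c) * (R p - \<tau> p)"
      using first[of p] second[of p] by (simp_all add: u algebra_simps)
    then have "(b * c - a * c) * (R p - \<tau> p) = 0"
      by algebra
    then have "(b - a) * (R p - \<tau> p) = 0"
      using c by (simp flip: right_diff_distrib left_diff_distrib)
    with * show ?thesis by algebra
  qed
  have U': "(\<lambda>p. (a + b) * U p) = (\<lambda>p. 2 * (R p - \<tau> p) * (a * fst (snd (snd p)) + c))"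
    and V': "(\<lambda>p. (a + b) * V p) = (\<lambda>p. d_t X p - (a + b) * snd (snd (snd p)) * (\<tau> p - R p))"
    using U C2 by auto
  have dU: "d_x U = (\<lambda>_. 0)" "(a + b) * d_t U p = 2 * (d_t R p - d_t \<tau> p) * (a * fst (snd (snd p)) + c)" for p
    using arg_cong[OF U', of d_x] arg_cong[OF U', of "\<lambda>f. d_t f p"] A by (simp_all add: C1 fun_eq_iff)
  have dV: "(\<lambda>p. (a + b) * d_x V p) = d_t R"
    "(a + b) * d_t V p = d_t (d_t X) p - (a + b) * snd (snd (snd p)) * (d_t \<tau> p - d_t R p)" for p
    using arg_cong[OF V', of d_x] arg_cong[OF V', of "\<lambda>f. d_t f p"] by (simp_all add: C1)
  have dxV: "d_x (d_x V) = (\<lambda>_. 0)"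
    using arg_cong[OF dV(1), of d_x] A by (simp add: C1 fun_eq_iff)
  have "(a * fst (snd (snd p)) + c) * (3 * d_t R p - 2 * d_t \<tau> p) = 0" for p
    using jet_free_terms(1)[of p, simplified dU(1) dxV, simplified] dU(2)[of p] fun_cong[OF dV(1), of p]
    by algebra
  then have "(\<lambda>p. 3 * d_t R p - 2 * d_t \<tau> p) = (\<lambda>_. 0)"
    by (intro affine_factor_cancel[OF _ c]) simp_all
  from fun_cong[OF this] have 1: "3 * d_t R p = 2 * d_t \<tau> p" for p
    by simp
  have "d_t (d_t X) p - (a + b) * snd (snd (snd p)) * (d_t \<tau> p - 2 * d_t R p) = 0" for p
    using jet_free_terms(2)[of p, simplified dU(1) dxV, simplified] dV(2)[of p] fun_cong[OF dV(1), of p]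
    by algebra
  then have 2: "(\<lambda>p. d_t (d_t X) p - (a + b) * snd (snd (snd p)) * (d_t \<tau> p - 2 * d_t R p)) = (\<lambda>_. 0)"
    by auto
  from arg_cong[OF 2, of "\<lambda>f. d_v f p" for p] A have 3: "d_t \<tau> p = 2 * d_t R p" for p
    by simp
  have 4: "d_t R = (\<lambda>_. 0)" "d_t \<tau> = (\<lambda>_. 0)"
    using 1 3 by (auto simp: fun_eq_iff)
  then have 5: "d_t (d_t X) = (\<lambda>_. 0)"
    using 2 by simp
  have const: "\<exists>k. \<forall>p. f p = (a + b) * k"
    if "smooth f" "d_t f = (\<lambda>_. 0)" "d_x f = (\<lambda>_. 0)" "d_u f = (\<lambda>_. 0)" "d_v f = (\<lambda>_. 0)" for f
  proof -
    note vanishing = that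
    obtain f0 where "\<And>t x u v. f (t, x, u, v) = f0 + 0 * t + 0 * x + 0 * u + 0 * v"
      by (rule affine_if_pd_const[OF vanishing]) (rule that)
    then have "f p = (a + b) * (f0 / (a + b))" for p
      using A by (cases p) simp
    then show ?thesis by blast
  qed
  obtain \<alpha> where \<alpha>: "\<And>p. \<tau> p = (a + b) * \<alpha>"
    using const[of \<tau>] by (auto simp: 4)
  obtain \<beta> where \<beta>: "\<And>p. R p = (a + b) * \<beta>"
    using const[of R] by (auto simp: 4 C1)
  obtain g where g: "\<And>p. d_t X p = (a + b) * g"
    using const[of "d_t X"] by (auto simp: 4 5)
  obtain s where T: "\<And>t x u v. T (t, x, u, v) = s + (a + b) * \<alpha> * t + 0 * x + 0 * u + 0 * v"
    by (rule affine_if_pd_const[of T "(a + b) * \<alpha>" 0 0 0]) (simp_all add: \<alpha> fun_eq_iff)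
  obtain r where X: "\<And>t x u v. X (t, x, u, v) = r + (a + b) * g * t + (a + b) * \<beta> * x + 0 * u + 0 * v"
    by (rule affine_if_pd_const[of X "(a + b) * g" "(a + b) * \<beta>" 0 0]) (simp_all add: \<beta> g fun_eq_iff)
  have "(a + b) * U p = (a + b) * (2 * (\<beta> - \<alpha>) * (a * fst (snd (snd p)) + c))"
    "(a + b) * V p = (a + b) * (g + (a + b) * (\<beta> - \<alpha>) * snd (snd (snd p)))" for p
    using U[of p] C2[of p] by (simp_all add: \<alpha> \<beta> g algebra_simps)
  then have components: "U p = 2 * (\<beta> - \<alpha>) * (a * fst (snd (snd p)) + c)"
    "V p = g + (a + b) * (\<beta> - \<alpha>) * snd (snd (snd p))" for p
    using A by (simp_all only: mult_cancel_left simp_thms)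
  show thesis
    by (rule that[of s \<alpha> r g \<beta>]) (auto simp: vf_def T X components)
qed

end

section \<open>Symmetries as combinations of the five generators\<close>

definition pair_coeff :: "real \<Rightarrow> real \<Rightarrow> dep_var \<Rightarrow> real"
  where "pair_coeff x y w = (case w of U_var \<Rightarrow> x | V_var \<Rightarrow> y)"

lemma pair_coeff_simps [simp]: "pair_coeff x y U_var = x" "pair_coeff x y V_var = y"
  by (simp_all add: pair_coeff_def)

definition combination where
  "combination a b c \<alpha> \<beta> s g r =
     \<alpha> *\<^sub>R X1 a b c + \<beta> *\<^sub>R X3 a b c + s *\<^sub>R X2 + g *\<^sub>R X4 a b + r *\<^sub>R X5"

lemma combination_apply:
  "combination a b c \<alpha> \<beta> s g r = (\<lambda>(t, x, u, v).
     (s + (a + b) * \<alpha> * t, r + (a + b) * g * t + (a + b) * \<beta> * x,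
      2 * (\<beta> - \<alpha>) * (a * u + c), g + (a + b) * (\<beta> - \<alpha>) * v))"
  by (auto simp: combination_def X1_def X2_def X3_def X4_def X5_def scaleR_fun_def plus_fun_def fun_eq_iff
      algebra_simps)

lemma combination_vf:
  "combination a b c \<alpha> \<beta> s g r = vf
     (\<lambda>p. s + (a + b) * \<alpha> * fst p) (\<lambda>p. r + (a + b) * g * fst p + (a + b) * \<beta> * fst (snd p))
     (\<lambda>w p. case w of U_var \<Rightarrow> 2 * (\<beta> - \<alpha>) * (a * fst (snd (snd p)) + c)
        | V_var \<Rightarrow> g + (a + b) * (\<beta> - \<alpha>) * snd (snd (snd p)))"
  by (auto simp: combination_apply vf_def)

text \<open>The multiplier of each equation is its weight under the scaling part of the field.  The remaining
  terms measure how far the dispersive terms, and the coefficient \<open>b u + c\<close> next to \<open>a u + c\<close>, are from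
  having the same weight.\<close>

lemma prolong_combination:
  fixes a b c \<alpha> \<beta> s g r \<epsilon> \<kappa> lam \<sigma> :: real
  defines "Y \<equiv> combination a b c \<alpha> \<beta> s g r"
  shows "prolong 3 Y (lhs1 a b c \<epsilon> \<kappa>) z = (2 * a * (\<beta> - \<alpha>) - (a + b) * \<alpha>) * lhs1 a b c \<epsilon> \<kappa> z
      - (a + b) * \<epsilon> * (2 * \<beta> * z (Der U_var 1 2) + g * z (Der U_var 0 3))
      - 2 * \<kappa> * ((2 * a + b) * \<beta> - a * \<alpha>) * z (Der V_var 0 3)"
    and "prolong 3 Y (lhs2 a b c lam \<sigma>) z = (a + b) * (\<beta> - 2 * \<alpha>) * lhs2 a b c lam \<sigma> z
      - (a + b) * \<sigma> * (2 * \<beta> * z (Der V_var 1 2) + g * z (Der V_var 0 3))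
      + 2 * lam * (b * \<alpha> - (a + 2 * b) * \<beta>) * z (Der U_var 0 3)
      + 2 * b * (a - b) * (\<beta> - \<alpha>) * z (Der U_var 0 0) * z (Der U_var 0 1)"
proof -
  define T :: scalar where "T = (\<lambda>p. s + (a + b) * \<alpha> * fst p)"
  define X :: scalar where "X = (\<lambda>p. r + (a + b) * g * fst p + (a + b) * \<beta> * fst (snd p))"
  define W :: "dep_var \<Rightarrow> scalar" where "W = (\<lambda>w p. case w of U_var \<Rightarrow> 2 * (\<beta> - \<alpha>) * (a * fst (snd (snd p)) + c)
        | V_var \<Rightarrow> g + (a + b) * (\<beta> - \<alpha>) * snd (snd (snd p)))"
  have W: "W U_var = (\<lambda>p. 2 * (\<beta> - \<alpha>) * (a * fst (snd (snd p)) + c))"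
    "W V_var = (\<lambda>p. g + (a + b) * (\<beta> - \<alpha>) * snd (snd (snd p)))"
    by (simp_all add: W_def)
  have Y: "Y = vf T X W"
    by (simp add: Y_def combination_vf T_def X_def W_def)
  have sm: "smooth T" "smooth X" "smooth (W w)" for w
    by (simp_all add: T_def X_def) (cases w; simp add: W)
  note vf = prolong_coeff_vf[OF sm] coeff_vf[OF sm]
  have d: "d_t T = (\<lambda>_. (a + b) * \<alpha>)" "d_x T = (\<lambda>_. 0)" "d_u T = (\<lambda>_. 0)" "d_v T = (\<lambda>_. 0)"
    "d_t X = (\<lambda>_. (a + b) * g)" "d_x X = (\<lambda>_. (a + b) * \<beta>)" "d_u X = (\<lambda>_. 0)" "d_v X = (\<lambda>_. 0)"
    "d_t (W w) = (\<lambda>_. 0)" "d_x (W w) = (\<lambda>_. 0)"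
    "d_u (W U_var) = (\<lambda>_. 2 * a * (\<beta> - \<alpha>))" "d_v (W U_var) = (\<lambda>_. 0)"
    "d_u (W V_var) = (\<lambda>_. 0)" "d_v (W V_var) = (\<lambda>_. (a + b) * (\<beta> - \<alpha>))" for w
    by (simp_all add: T_def X_def W fun_eq_iff algebra_simps) (cases w; simp add: W)+
  note D = Dx_def Dt_def Dxx_def Dtx_def Dxxx_def Dtxx_def d
  show "prolong 3 Y (lhs1 a b c \<epsilon> \<kappa>) z = (2 * a * (\<beta> - \<alpha>) - (a + b) * \<alpha>) * lhs1 a b c \<epsilon> \<kappa> z
      - (a + b) * \<epsilon> * (2 * \<beta> * z (Der U_var 1 2) + g * z (Der U_var 0 3))
      - 2 * \<kappa> * ((2 * a + b) * \<beta> - a * \<alpha>) * z (Der V_var 0 3)"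
    unfolding Y prolong_lhs lhs1_def prolong_coeff.simps(1) vf
    by (simp add: D W base_def algebra_simps)
  show "prolong 3 Y (lhs2 a b c lam \<sigma>) z = (a + b) * (\<beta> - 2 * \<alpha>) * lhs2 a b c lam \<sigma> z
      - (a + b) * \<sigma> * (2 * \<beta> * z (Der V_var 1 2) + g * z (Der V_var 0 3))
      + 2 * lam * (b * \<alpha> - (a + 2 * b) * \<beta>) * z (Der U_var 0 3)
      + 2 * b * (a - b) * (\<beta> - \<alpha>) * z (Der U_var 0 0) * z (Der U_var 0 1)"
    unfolding Y prolong_lhs lhs2_def prolong_coeff.simps(1) vf
    by (simp add: D W base_def algebra_simps)
qed

lemma smooth_combination: "smooth (combination a b c \<alpha> \<beta> s g r)"
  unfolding combination_vf vf_def dep_var.case by (intro smooth_Pair) simp_all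

lemma lhs_on_shell:
  fixes a b c \<epsilon> \<kappa> lam \<sigma> :: real and z :: jet
  defines "z' \<equiv> on_shell a b c (pair_coeff \<epsilon> \<sigma>) (pair_coeff \<kappa> lam) z"
  shows "lhs1 a b c \<epsilon> \<kappa> z' = 0" "lhs2 a b c lam \<sigma> z' = 0"
  by (simp_all add: z'_def lhs1_def lhs2_def)

text \<open>For necessity, one derivative at a time is set to 1; the term with \<open>u u\<^sub>x\<close> is seen over a point
  with \<open>u = 1\<close>.\<close>

lemma combination_symmetry_iff:
  assumes A: "a + b \<noteq> 0"
  shows "combination a b c \<alpha> \<beta> s g r \<in> symmetries a b c \<epsilon> \<kappa> lam \<sigma> \<longleftrightarrow>
    \<kappa> * ((2 * a + b) * \<beta> - a * \<alpha>) = 0 \<and> lam * (b * \<alpha> - (a + 2 * b) * \<beta>) = 0 \<and>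
    ((\<epsilon>, \<sigma>) \<noteq> (0, 0) \<longrightarrow> \<beta> = 0 \<and> g = 0) \<and> b * (a - b) * (\<beta> - \<alpha>) = 0" (is "?S \<longleftrightarrow> ?C")
proof
  assume ?C
  then have "\<epsilon> * \<beta> = 0 \<and> \<epsilon> * g = 0 \<and> \<sigma> * \<beta> = 0 \<and> \<sigma> * g = 0"
    "\<kappa> * ((2 * a + b) * \<beta> - a * \<alpha>) = 0" "lam * (b * \<alpha> - (a + 2 * b) * \<beta>) = 0" "b * (a - b) * (\<beta> - \<alpha>) = 0"
    by auto
  then show ?S
    by (auto simp: symmetries_def symmetry_generator_def smooth_combination prolong_combination)
next
  assume S: ?S
  let ?Y = "combination a b c \<alpha> \<beta> s g r"
  define sh where "sh = on_shell a b c (pair_coeff \<epsilon> \<sigma>) (pair_coeff \<kappa> lam)"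
  have 0: "lhs1 a b c \<epsilon> \<kappa> (sh z) = 0" "lhs2 a b c lam \<sigma> (sh z) = 0" for z
    by (simp_all add: sh_def lhs_on_shell)
  have *: "prolong 3 ?Y (lhs1 a b c \<epsilon> \<kappa>) (sh z) = 0" "prolong 3 ?Y (lhs2 a b c lam \<sigma>) (sh z) = 0" for z
    using S 0[of z] by (auto simp: symmetries_def symmetry_generator_def)
  note ** = *[unfolded prolong_combination 0]
  let ?z = "over (0, 0, 1, 0)"
  show ?C
    using **[of "?z(Der U_var 1 2 := 1)"] **[of "?z(Der U_var 0 3 := 1)"]
      **[of "?z(Der V_var 1 2 := 1)"] **[of "?z(Der V_var 0 3 := 1)"] **[of "?z(Der U_var 0 1 := 1)"] A
    by (auto simp: sh_def)
qed

lemma symmetry_is_combination: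
  fixes a b c \<epsilon> \<kappa> lam \<sigma> :: real
  assumes Ac: "(a + b) * c \<noteq> 0" and disp: "\<not> (\<epsilon> = 0 \<and> \<kappa> = 0 \<and> lam = 0 \<and> \<sigma> = 0)"
    and Y: "Y \<in> symmetries a b c \<epsilon> \<kappa> lam \<sigma>"
  obtains \<alpha> \<beta> s g r where "Y = combination a b c \<alpha> \<beta> s g r"
proof -
  define T X where "T = (\<lambda>p. fst (Y p))" and "X = (\<lambda>p. fst (snd (Y p)))"
  define W where "W = (\<lambda>w p. case w of U_var \<Rightarrow> fst (snd (snd (Y p))) | V_var \<Rightarrow> snd (snd (snd (Y p))))"
  let ?e = "pair_coeff \<epsilon> \<sigma>" and ?k = "pair_coeff \<kappa> lam"
  have Y_eq: "Y = vf T X W"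
    by (auto simp: vf_def T_def X_def W_def)
  have smY: "smooth Y"
    using Y by (simp add: symmetries_def symmetry_generator_def)
  interpret infinitesimal_symmetry a b c ?e ?k T X W
  proof
    show "smooth T" "smooth X"
      unfolding T_def X_def by (intro smooth_linear_compose[OF _ smY] bounded_linear_coordinates)+
    show "smooth (W w)" for w
      unfolding W_def by (cases w) (simp_all add: smooth_linear_compose[OF bounded_linear_coordinates(3) smY]
        smooth_linear_compose[OF bounded_linear_coordinates(4) smY])
    show "\<exists>w. ?e w \<noteq> 0 \<or> ?k w \<noteq> 0"
      using disp by (metis pair_coeff_simps)
    fix z w
    assume z: "z = on_shell a b c ?e ?k z"
    have "lhs1 a b c \<epsilon> \<kappa> z = 0" "lhs2 a b c lam \<sigma> z = 0"
      by (subst z, rule lhs_on_shell)+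
    then have "prolong 3 (vf T X W) (lhs1 a b c \<epsilon> \<kappa>) z = 0" "prolong 3 (vf T X W) (lhs2 a b c lam \<sigma>) z = 0"
      using Y by (simp_all add: symmetries_def symmetry_generator_def Y_eq)
    then show "variation a b c ?e ?k T X W w z = 0"
      by (cases w) (simp_all add: variation_def Let_def prolong_lhs ac_simps del: prolong_coeff.simps)
  qed
  show thesis
    by (rule generator_normal_form[OF Ac], rule that) (simp add: Y_eq combination_apply)
qed

lemma symmetries_eq:
  assumes "(a + b) * c \<noteq> 0" "\<not> (\<epsilon> = 0 \<and> \<kappa> = 0 \<and> lam = 0 \<and> \<sigma> = 0)"
  shows "symmetries a b c \<epsilon> \<kappa> lam \<sigma> = {combination a b c \<alpha> \<beta> s g r | \<alpha> \<beta> s g r.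
    \<kappa> * ((2 * a + b) * \<beta> - a * \<alpha>) = 0 \<and> lam * (b * \<alpha> - (a + 2 * b) * \<beta>) = 0 \<and>
    ((\<epsilon>, \<sigma>) \<noteq> (0, 0) \<longrightarrow> \<beta> = 0 \<and> g = 0) \<and> b * (a - b) * (\<beta> - \<alpha>) = 0}"
proof -
  have A: "a + b \<noteq> 0" using assms(1) by simp
  show ?thesis
  proof (intro set_eqI iffI)
    fix Y assume Y: "Y \<in> symmetries a b c \<epsilon> \<kappa> lam \<sigma>"
    then obtain \<alpha> \<beta> s g r where "Y = combination a b c \<alpha> \<beta> s g r"
      using symmetry_is_combination[OF assms] by blast
    with Y combination_symmetry_iff[OF A, of c \<alpha> \<beta> s g r \<epsilon> \<kappa> lam \<sigma>]
    show "Y \<in> {combination a b c \<alpha> \<beta> s g r | \<alpha> \<beta> s g r.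
      \<kappa> * ((2 * a + b) * \<beta> - a * \<alpha>) = 0 \<and> lam * (b * \<alpha> - (a + 2 * b) * \<beta>) = 0 \<and>
      ((\<epsilon>, \<sigma>) \<noteq> (0, 0) \<longrightarrow> \<beta> = 0 \<and> g = 0) \<and> b * (a - b) * (\<beta> - \<alpha>) = 0}"
      by blast
  qed (use combination_symmetry_iff[OF A] in blast)
qed

lemma combination_linear:
  "combination a b c \<alpha> \<beta> s g r + combination a b c \<alpha>' \<beta>' s' g' r'
    = combination a b c (\<alpha> + \<alpha>') (\<beta> + \<beta>') (s + s') (g + g') (r + r')"
  "q *\<^sub>R combination a b c \<alpha> \<beta> s g r
    = combination a b c (q * \<alpha>) (q * \<beta>) (q * s) (q * g) (q * r)"
  by (simp_all add: combination_def scaleR_add_left scaleR_add_right)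

text \<open>By \<open>combination_symmetry_iff\<close> membership is a system of homogeneous linear conditions.\<close>

lemma subspace_symmetries:
  assumes "(a + b) * c \<noteq> 0" "\<not> (\<epsilon> = 0 \<and> \<kappa> = 0 \<and> lam = 0 \<and> \<sigma> = 0)"
  shows "subspace (symmetries a b c \<epsilon> \<kappa> lam \<sigma>)"
proof -
  have A: "a + b \<noteq> 0" using assms(1) by simp
  note mem = combination_symmetry_iff[OF A]
  have "0 = combination a b c 0 0 0 0 0" by (simp add: combination_def)
  then have zero: "0 \<in> symmetries a b c \<epsilon> \<kappa> lam \<sigma>"
    using mem[of c 0 0 0 0 0 \<epsilon> \<kappa> lam \<sigma>] by simp
  have add: "x + y \<in> symmetries a b c \<epsilon> \<kappa> lam \<sigma>"
    if x: "x \<in> symmetries a b c \<epsilon> \<kappa> lam \<sigma>" and y: "y \<in> symmetries a b c \<epsilon> \<kappa> lam \<sigma>" for x y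
  proof -
    from x[unfolded symmetries_eq[OF assms]] y[unfolded symmetries_eq[OF assms]]
    obtain \<alpha> \<beta> s g r \<alpha>' \<beta>' s' g' r' where
      x: "x = combination a b c \<alpha> \<beta> s g r" "y = combination a b c \<alpha>' \<beta>' s' g' r'" and
      C: "\<kappa> * ((2 * a + b) * \<beta> - a * \<alpha>) = 0" "\<kappa> * ((2 * a + b) * \<beta>' - a * \<alpha>') = 0"
        "lam * (b * \<alpha> - (a + 2 * b) * \<beta>) = 0" "lam * (b * \<alpha>' - (a + 2 * b) * \<beta>') = 0"
        "(\<epsilon>, \<sigma>) \<noteq> (0, 0) \<longrightarrow> \<beta> = 0 \<and> g = 0" "(\<epsilon>, \<sigma>) \<noteq> (0, 0) \<longrightarrow> \<beta>' = 0 \<and> g' = 0"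
        "b * (a - b) * (\<beta> - \<alpha>) = 0" "b * (a - b) * (\<beta>' - \<alpha>') = 0"
      by blast
    have "\<kappa> * ((2 * a + b) * (\<beta> + \<beta>') - a * (\<alpha> + \<alpha>')) = 0"
      using C(1,2) by algebra
    moreover have "lam * (b * (\<alpha> + \<alpha>') - (a + 2 * b) * (\<beta> + \<beta>')) = 0"
      using C(3,4) by algebra
    moreover have "b * (a - b) * ((\<beta> + \<beta>') - (\<alpha> + \<alpha>')) = 0"
      using C(7,8) by algebra
    ultimately show ?thesis
      using C(5,6) unfolding x combination_linear mem by simp
  qed
  have scale: "q *\<^sub>R x \<in> symmetries a b c \<epsilon> \<kappa> lam \<sigma>" if x: "x \<in> symmetries a b c \<epsilon> \<kappa> lam \<sigma>" for q x
  proof -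
    from x[unfolded symmetries_eq[OF assms]]
    obtain \<alpha> \<beta> s g r where
      x: "x = combination a b c \<alpha> \<beta> s g r" and
      C: "\<kappa> * ((2 * a + b) * \<beta> - a * \<alpha>) = 0" "lam * (b * \<alpha> - (a + 2 * b) * \<beta>) = 0"
        "(\<epsilon>, \<sigma>) \<noteq> (0, 0) \<longrightarrow> \<beta> = 0 \<and> g = 0" "b * (a - b) * (\<beta> - \<alpha>) = 0"
      by blast
    have "\<kappa> * ((2 * a + b) * (q * \<beta>) - a * (q * \<alpha>)) = 0"
      using C(1) by algebra
    moreover have "lam * (b * (q * \<alpha>) - (a + 2 * b) * (q * \<beta>)) = 0"
      using C(2) by algebra
    moreover have "b * (a - b) * (q * \<beta> - q * \<alpha>) = 0"
      using C(4) by algebra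
    ultimately show ?thesis
      using C(3) unfolding x combination_linear mem by simp
  qed
  show ?thesis
    unfolding subspace_def using zero add scale by blast
qed

lemma generators_as_combinations:
  "X1 a b c = combination a b c 1 0 0 0 0"
  "X2 = combination a b c 0 0 1 0 0"
  "X4 a b = combination a b c 0 0 0 1 0"
  "X5 = combination a b c 0 0 0 0 1"
  "2 *\<^sub>R X1 a b c + X3 a b c = combination a b c 2 1 0 0 0"
  "3 *\<^sub>R X1 a b c + X3 a b c = combination a b c 3 1 0 0 0"
  by (simp_all add: combination_def)

theorem proposition1:
  fixes a b c \<epsilon> \<kappa> lam \<sigma> :: real
  assumes "(a + b) * c \<noteq> 0"
    and "\<not> (\<epsilon> = 0 \<and> \<kappa> = 0 \<and> lam = 0 \<and> \<sigma> = 0)"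
  shows "(\<epsilon> = 0 \<and> \<sigma> = 0 \<longrightarrow>
      (b = 0 \<longrightarrow> symmetries a b c \<epsilon> \<kappa> lam \<sigma> =
         span ({X2, X4 a b, X5}
           \<union> (if \<kappa> = 0 then {X1 a b c} else {})
           \<union> (if lam = 0 then {2 *\<^sub>R X1 a b c + X3 a b c} else {})))
    \<and> (a = b \<longrightarrow> symmetries a b c \<epsilon> \<kappa> lam \<sigma> =
         span {3 *\<^sub>R X1 a b c + X3 a b c, X2, X4 a b, X5})
    \<and> (b * (a - b) \<noteq> 0 \<longrightarrow> symmetries a b c \<epsilon> \<kappa> lam \<sigma> =
         span {X2, X4 a b, X5}))
  \<and> ((\<epsilon>, \<sigma>) \<noteq> (0, 0) \<longrightarrow>
      (b = 0 \<longrightarrow> symmetries a b c \<epsilon> \<kappa> lam \<sigma> =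
         span ({X2, X5} \<union> (if \<kappa> = 0 then {X1 a b c} else {})))
    \<and> (a = b \<longrightarrow> symmetries a b c \<epsilon> \<kappa> lam \<sigma> =
         span ({X2, X5} \<union> (if \<kappa> = 0 \<and> lam = 0 then {X1 a b c} else {})))
    \<and> (b * (a - b) \<noteq> 0 \<longrightarrow> symmetries a b c \<epsilon> \<kappa> lam \<sigma> = span {X2, X5}))"
proof -
  have A: "a + b \<noteq> 0" using assms(1) by simp
  define S where "S = symmetries a b c \<epsilon> \<kappa> lam \<sigma>"
  let ?C = "\<lambda>\<alpha> \<beta> g. \<kappa> * ((2 * a + b) * \<beta> - a * \<alpha>) = 0 \<and> lam * (b * \<alpha> - (a + 2 * b) * \<beta>) = 0 \<and>
    ((\<epsilon>, \<sigma>) \<noteq> (0, 0) \<longrightarrow> \<beta> = 0 \<and> g = 0) \<and> b * (a - b) * (\<beta> - \<alpha>) = 0"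
  note mem = combination_symmetry_iff[OF A, of c _ _ _ _ _ \<epsilon> \<kappa> lam \<sigma>, folded S_def]
  have eq: "S = span G"
    if "G \<subseteq> S" "\<And>\<alpha> \<beta> s g r. ?C \<alpha> \<beta> g \<Longrightarrow> combination a b c \<alpha> \<beta> s g r \<in> span G" for G
  proof
    show "S \<subseteq> span G"
      unfolding S_def symmetries_eq[OF assms] using that(2) by blast
    show "span G \<subseteq> S"
      by (rule span_minimal[OF that(1) subspace_symmetries[OF assms, folded S_def]])
  qed
  have gen: "X2 \<in> S" "X5 \<in> S"
    "X4 a b \<in> S \<longleftrightarrow> \<epsilon> = 0 \<and> \<sigma> = 0"
    "X1 a b c \<in> S \<longleftrightarrow> \<kappa> * a = 0 \<and> lam * b = 0 \<and> b * (a - b) = 0"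
    "2 *\<^sub>R X1 a b c + X3 a b c \<in> S \<longleftrightarrow>
       \<kappa> * b = 0 \<and> lam * a = 0 \<and> \<epsilon> = 0 \<and> \<sigma> = 0 \<and> b * (a - b) = 0"
    "3 *\<^sub>R X1 a b c + X3 a b c \<in> S \<longleftrightarrow>
       \<kappa> * (a - b) = 0 \<and> lam * (a - b) = 0 \<and> \<epsilon> = 0 \<and> \<sigma> = 0 \<and> b * (a - b) = 0"
    by (subst generators_as_combinations[where a = a and b = b and c = c], subst mem, force)+
  \<comment> \<open>The part along \<open>X\<^sub>3\<close> is written with \<open>m X\<^sub>1 + X\<^sub>3\<close>; the theorem needs \<open>m = 2\<close> and \<open>m = 3\<close>.\<close>
  have comb: "combination a b c \<alpha> \<beta> s g r =
      (\<alpha> - m * \<beta>) *\<^sub>R X1 a b c + \<beta> *\<^sub>R (m *\<^sub>R X1 a b c + X3 a b c) + s *\<^sub>R X2 + g *\<^sub>R X4 a b + r *\<^sub>R X5"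
    for m \<alpha> \<beta> s g r
    by (simp add: combination_def algebra_simps)
  have in_span: "combination a b c \<alpha> \<beta> s g r \<in> span G"
    if "\<alpha> = m * \<beta> \<or> X1 a b c \<in> G" "\<beta> = 0 \<or> m *\<^sub>R X1 a b c + X3 a b c \<in> G" "X2 \<in> G" "g = 0 \<or> X4 a b \<in> G" "X5 \<in> G"
    for m \<alpha> \<beta> s g r G
  proof -
    have "q *\<^sub>R x \<in> span G" if "q = 0 \<or> x \<in> G" for q :: real and x :: vfield
      using that by (auto simp: span_zero intro: span_scale span_base)
    then show ?thesis
      unfolding comb[of \<alpha> \<beta> s g r m] using that by (intro span_add) auto
  qed
  show ?thesis
    unfolding S_def [symmetric]
  proof (intro conjI impI)
    assume e: "\<epsilon> = 0 \<and> \<sigma> = 0" and b: "b = 0"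
    show "S = span ({X2, X4 a b, X5} \<union> (if \<kappa> = 0 then {X1 a b c} else {})
        \<union> (if lam = 0 then {2 *\<^sub>R X1 a b c + X3 a b c} else {}))"
    proof (rule eq)
      show "({X2, X4 a b, X5} \<union> (if \<kappa> = 0 then {X1 a b c} else {})
        \<union> (if lam = 0 then {2 *\<^sub>R X1 a b c + X3 a b c} else {})) \<subseteq> S"
        by (simp add: gen split: if_split) (use e b in auto)
      show "combination a b c \<alpha> \<beta> s g r \<in> span ({X2, X4 a b, X5} \<union> (if \<kappa> = 0 then {X1 a b c} else {})
        \<union> (if lam = 0 then {2 *\<^sub>R X1 a b c + X3 a b c} else {}))" if "?C \<alpha> \<beta> g" for \<alpha> \<beta> s g r
        by (rule in_span[of _ 2]) (use that e b A in auto)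
    qed
  next
    assume e: "\<epsilon> = 0 \<and> \<sigma> = 0" and b: "a = b"
    have "\<alpha> = 3 * \<beta>" if "?C \<alpha> \<beta> g" for \<alpha> \<beta> g
    proof -
      have "\<kappa> * (b * (3 * \<beta> - \<alpha>)) = 0" "lam * (b * (\<alpha> - 3 * \<beta>)) = 0"
        using that b by (simp_all add: algebra_simps)
      then show ?thesis using e b A assms(2) by auto
    qed
    note rel = this
    show "S = span {3 *\<^sub>R X1 a b c + X3 a b c, X2, X4 a b, X5}"
    proof (rule eq)
      show "{3 *\<^sub>R X1 a b c + X3 a b c, X2, X4 a b, X5} \<subseteq> S"
        by (simp add: gen) (use e b in auto)
      show "combination a b c \<alpha> \<beta> s g r \<in> span {3 *\<^sub>R X1 a b c + X3 a b c, X2, X4 a b, X5}"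
        if "?C \<alpha> \<beta> g" for \<alpha> \<beta> s g r
        by (rule in_span[of _ 3]) (use rel[OF that] in auto)
    qed
  next
    assume e: "\<epsilon> = 0 \<and> \<sigma> = 0" and b: "b * (a - b) \<noteq> 0"
    have "\<alpha> = 0 \<and> \<beta> = 0" if "?C \<alpha> \<beta> g" for \<alpha> \<beta> g
    proof -
      have \<alpha>: "\<alpha> = \<beta>" using that b by auto
      have "\<kappa> * ((a + b) * \<beta>) = 0" "lam * ((a + b) * \<beta>) = 0"
        using that unfolding \<alpha> by (simp_all add: algebra_simps)
      then show ?thesis using e A assms(2) \<alpha> by auto
    qed
    note rel = this
    show "S = span {X2, X4 a b, X5}"
    proof (rule eq)
      show "{X2, X4 a b, X5} \<subseteq> S"
        by (simp add: gen) (use e in auto)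
      show "combination a b c \<alpha> \<beta> s g r \<in> span {X2, X4 a b, X5}" if "?C \<alpha> \<beta> g" for \<alpha> \<beta> s g r
        by (rule in_span[of _ 0]) (use rel[OF that] in auto)
    qed
  next
    assume e: "(\<epsilon>, \<sigma>) \<noteq> (0, 0)" and b: "b = 0"
    show "S = span ({X2, X5} \<union> (if \<kappa> = 0 then {X1 a b c} else {}))"
    proof (rule eq)
      show "({X2, X5} \<union> (if \<kappa> = 0 then {X1 a b c} else {})) \<subseteq> S"
        by (simp add: gen split: if_split) (use e b in auto)
      show "combination a b c \<alpha> \<beta> s g r \<in> span ({X2, X5} \<union> (if \<kappa> = 0 then {X1 a b c} else {}))" if "?C \<alpha> \<beta> g" for \<alpha> \<beta> s g r
        by (rule in_span[of _ 0]) (use that e b A in auto)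
    qed
  next
    assume e: "(\<epsilon>, \<sigma>) \<noteq> (0, 0)" and b: "a = b"
    show "S = span ({X2, X5} \<union> (if \<kappa> = 0 \<and> lam = 0 then {X1 a b c} else {}))"
    proof (rule eq)
      show "({X2, X5} \<union> (if \<kappa> = 0 \<and> lam = 0 then {X1 a b c} else {})) \<subseteq> S"
        by (simp add: gen split: if_split) (use e b in auto)
      show "combination a b c \<alpha> \<beta> s g r \<in> span ({X2, X5} \<union> (if \<kappa> = 0 \<and> lam = 0 then {X1 a b c} else {}))" if "?C \<alpha> \<beta> g" for \<alpha> \<beta> s g r
        by (rule in_span[of _ 0]) (use that e b A in auto)
    qed
  next
    assume e: "(\<epsilon>, \<sigma>) \<noteq> (0, 0)" and b: "b * (a - b) \<noteq> 0"
    show "S = span {X2, X5}"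
    proof (rule eq)
      show "{X2, X5} \<subseteq> S"
        by (simp add: gen)
      show "combination a b c \<alpha> \<beta> s g r \<in> span {X2, X5}" if "?C \<alpha> \<beta> g" for \<alpha> \<beta> s g r
        by (rule in_span[of _ 0]) (use that e b A in auto)
    qed
  qed
qed

end
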